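(* Let $C$ be a cocommutative $k$-coalgebra and let $(\Psi,\psi)$ be a $C$-measuring of Lie-Rinehart algebras from $(R,\mathfrak L,\nabla)$ to $(R',\mathfrak L',\nabla')$. Then $(\Psi,\psi)$ induces a measuring $\mathcal V(\Psi,\psi):C\longrightarrow Vect_k(\mathcal V(R,\mathfrak L,\nabla),\mathcal V(R',\mathfrak L',\nabla'))$ of universal enveloping algebras.
   Context: $k$ is a field containing $\mathbb Q$; $Vect_k(V,W)$ denotes the space of $k$-linear maps from $V$ to $W$; the coproduct of a coalgebra $C$ is written $\Delta_C(x)=x_{(1)}\otimes x_{(2)}$ (Sweedler notation with summation suppressed), and its counit is $\epsilon_C$. A Lie-Rinehart algebra $(R,\mathfrak L)$ over $k$: $R$ is a commutative $k$-algebra, $\mathfrak L$ is an $R$-module which is also a Lie algebra over $k$ and is equipped with a morphism of Lie algebras $\mathfrak L\to Der_k(R)$ (the $k$-linear derivations of $R$), $Z\mapsto(r\mapsto Z(r))$, such that $(rZ)(r')=r(Z(r'))$ and $[Z,rZ']=r[Z,Z']+Z(r)Z'$ for $r,r'\in R$, $Z,Z'\in\mathfrak L$. A (right) connection is a linear map $\nabla:\mathfrak L\otimes R\to R$, written $Z\otimes r\mapsto\nabla_Z(r)$, with $\nabla_Z(r'r)=r'\nabla_Z(r)-Z(r')r=\nabla_{r'Z}(r)$; it is flat if $[\nabla_Z,\nabla_{Z'}]=\nabla_{[Z',Z]}$ for all $Z,Z'\in\mathfrak L$. Throughout, a Lie-Rinehart algebra $(R,\mathfrak L,\nabla)$ is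 equipped with a flat connection $\nabla$, and $\mathfrak L$ is projective as an $R$-module. A measuring of algebras from a $k$-algebra $B$ to a $k$-algebra $B'$ by a coalgebra $C$ is a linear map $C\to Vect_k(B,B')$, $x\mapsto x(-)$, with $x(bb')=x_{(1)}(b)x_{(2)}(b')$ and $x(1_B)=\epsilon_C(x)1_{B'}$ for $x\in C$, $b,b'\in B$. A $C$-measuring $(\Psi,\psi)$ from $(R,\mathfrak L,\nabla)$ to $(R',\mathfrak L',\nabla')$, for $C$ a cocommutative $k$-coalgebra, is a pair of linear maps $\Psi:C\to Vect_k(\mathfrak L,\mathfrak L')$ and $\psi:C\to Vect_k(R,R')$ (write $x(Z)=\Psi(x)(Z)$ and $x(r)=\psi(x)(r)$) such that (a) $\psi$ is a measuring of algebras; (b) $x([Z_1,Z_2])=[x_{(1)}(Z_1),x_{(2)}(Z_2)]$ for $x\in C$, $Z_1,Z_2\in\mathfrak L$; (c) $x(Z(r))=(x_{(1)}(Z))(x_{(2)}(r))$, $x(\nabla_Z(r))=\nabla'_{x_{(1)}(Z)}(x_{(2)}(r))$ and $x(rZ)=x_{(1)}(r)x_{(2)}(Z)$ for $x\in C$, $r\in R$, $Z\in\mathfrak L$. The universal enveloping algebra $\mathcal V(R,\mathfrak L,\nabla)$: make $R\oplus\mathfrak L$ a $k$-Lie algebra by $[(r_1,Z_1),(r_2,Z_2)]=(Z_1(r_2)-Z_2(r_1),[Z_1,Z_2])$; let $\mathcal U(R\oplus\mathfrak L)$ be the universal enveloping algebra of this Lie algebra, and let $\bar{\mathcal U}(R\oplus\mathfrak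 L)$ be its subalgebra generated by the elements in the image of $R\oplus\mathfrak L$. Write $\overline{(r,Z)}$ for the image of $(r,Z)$ in $\bar{\mathcal U}(R\oplus\mathfrak L)$ and $\overline r=\overline{(r,0)}$. Then $\mathcal V(R,\mathfrak L,\nabla)$ is the quotient of $\bar{\mathcal U}(R\oplus\mathfrak L)$ by the two-sided ideal generated by all elements $\overline{(r_1r_2,r_1Z_2)}-\overline{r_1}\cdot\overline{(r_2,Z_2)}$ with $r_1\in R$, $(r_2,Z_2)\in R\oplus\mathfrak L$, where $\cdot$ is the product of $\bar{\mathcal U}(R\oplus\mathfrak L)$. *)

theory Defs
  imports
    Complex_Main
    "HOL-Algebra.QuotRing"
    "HOL-Algebra.Module"
    "HOL-Library.Poly_Mapping"
    "HOL-Library.Product_Plus"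
begin

text \<open>
  The ground field is a type \<open>'k::field_char_0\<close>. Vector spaces, the commutative algebra \<open>R\<close>, the
  module \<open>L\<close> and coalgebras are types with explicit scalar multiplications. The enveloping algebras
  are quotients depending on such data, so they are given as records of type
  \<^typ>\<open>('k, 'a) module\<close> from HOL-Algebra, with an explicit carrier.
\<close>

section \<open>Algebras over a field, generated ideals and subalgebras, quotients\<close>

definition type_alg :: "('k \<Rightarrow> 'a \<Rightarrow> 'a) \<Rightarrow> ('k, 'a::{ring, monoid_mult}) module" where
  "type_alg s = \<lparr>carrier = UNIV, monoid.mult = (*), one = 1, ring.zero = 0, add = (+), smult = s\<rparr>"

text \<open>Here \<^term>\<open>type_alg (*)\<close> is the field \<open>k\<close> itself, seen as a HOL-Algebra ring.\<close>

definition k_algebra :: "('k::field, 'a) module \<Rightarrow> bool" where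
  "k_algebra B \<longleftrightarrow> ring B \<and> module (type_alg ((*) :: 'k \<Rightarrow> 'k \<Rightarrow> 'k)) B \<and>
    (\<forall>c. \<forall>x\<in>carrier B. \<forall>y\<in>carrier B.
      (c \<odot>\<^bsub>B\<^esub> x) \<otimes>\<^bsub>B\<^esub> y = c \<odot>\<^bsub>B\<^esub> (x \<otimes>\<^bsub>B\<^esub> y) \<and>
      x \<otimes>\<^bsub>B\<^esub> (c \<odot>\<^bsub>B\<^esub> y) = c \<odot>\<^bsub>B\<^esub> (x \<otimes>\<^bsub>B\<^esub> y))"

text \<open>
  Two-sided ideals are required to be subspaces: this matters because \<open>B\<close> need not have a unit.
\<close>

inductive_set ideal_gen :: "('k, 'a) module \<Rightarrow> 'a set \<Rightarrow> 'a set"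
  for B :: "('k, 'a) module" and S :: "'a set" where
  "s \<in> S \<Longrightarrow> s \<in> ideal_gen B S"
| "\<zero>\<^bsub>B\<^esub> \<in> ideal_gen B S"
| "x \<in> ideal_gen B S \<Longrightarrow> y \<in> ideal_gen B S \<Longrightarrow> x \<oplus>\<^bsub>B\<^esub> y \<in> ideal_gen B S"
| "x \<in> ideal_gen B S \<Longrightarrow> c \<odot>\<^bsub>B\<^esub> x \<in> ideal_gen B S"
| "x \<in> ideal_gen B S \<Longrightarrow> b \<in> carrier B \<Longrightarrow> b \<otimes>\<^bsub>B\<^esub> x \<in> ideal_gen B S"
| "x \<in> ideal_gen B S \<Longrightarrow> b \<in> carrier B \<Longrightarrow> x \<otimes>\<^bsub>B\<^esub> b \<in> ideal_gen B S"

text \<open>The subalgebra generated by \<open>S\<close>, not required to contain the unit of \<open>B\<close>.\<close>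

inductive_set subalgebra_gen :: "('k, 'a) module \<Rightarrow> 'a set \<Rightarrow> 'a set"
  for B :: "('k, 'a) module" and S :: "'a set" where
  "s \<in> S \<Longrightarrow> s \<in> subalgebra_gen B S"
| "\<zero>\<^bsub>B\<^esub> \<in> subalgebra_gen B S"
| "x \<in> subalgebra_gen B S \<Longrightarrow> y \<in> subalgebra_gen B S \<Longrightarrow> x \<oplus>\<^bsub>B\<^esub> y \<in> subalgebra_gen B S"
| "x \<in> subalgebra_gen B S \<Longrightarrow> c \<odot>\<^bsub>B\<^esub> x \<in> subalgebra_gen B S"
| "x \<in> subalgebra_gen B S \<Longrightarrow> y \<in> subalgebra_gen B S \<Longrightarrow> x \<otimes>\<^bsub>B\<^esub> y \<in> subalgebra_gen B S"

definition alg_quot :: "('k, 'a) module \<Rightarrow> 'a set \<Rightarrow> ('k, 'a set) module" where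
  "alg_quot B I = ring.extend (B Quot I)
     (module.fields (\<lambda>c X. \<Union>x\<in>X. I +>\<^bsub>B\<^esub> (c \<odot>\<^bsub>B\<^esub> x)))"

section \<open>Free algebras\<close>

text \<open>
  Lists with concatenation are the free monoid, so \<^typ>\<open>'a list \<Rightarrow>\<^sub>0 'k\<close> with its convolution product
  is the free unital associative \<open>k\<close>-algebra on the set \<^typ>\<open>'a\<close>.
\<close>

instantiation list :: (type) monoid_add
begin
definition zero_list_def: "0 = []"
definition plus_list_def: "xs + ys = xs @ ys"
instance by standard (simp_all add: zero_list_def plus_list_def)
end

definition scalar :: "'k \<Rightarrow> 'a list \<Rightarrow>\<^sub>0 'k::field" where
  "scalar c = Poly_Mapping.single 0 c"

definition gen :: "'a \<Rightarrow> 'a list \<Rightarrow>\<^sub>0 'k::field" where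
  "gen a = Poly_Mapping.single [a] 1"

definition free_algebra :: "('k::field, 'a list \<Rightarrow>\<^sub>0 'k) module" where
  "free_algebra = type_alg (\<lambda>c p. scalar c * p)"

text \<open>
  For a vector space with scalar multiplication \<open>s\<close>, the free algebra modulo the ideal generated by
  the following elements is the tensor algebra.
\<close>

definition lin_relators :: "('k::field \<Rightarrow> 'a::ab_group_add \<Rightarrow> 'a) \<Rightarrow> ('a list \<Rightarrow>\<^sub>0 'k) set" where
  "lin_relators s = {gen (a + b) - gen a - gen b | a b. True}
     \<union> {gen (s c a) - scalar c * gen a | c a. True}"

definition tensor_eq ::
  "('k::field \<Rightarrow> 'a::ab_group_add \<Rightarrow> 'a) \<Rightarrow> ('a list \<Rightarrow>\<^sub>0 'k) \<Rightarrow> ('a list \<Rightarrow>\<^sub>0 'k) \<Rightarrow> bool" where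
  "tensor_eq s t u \<longleftrightarrow> t - u \<in> ideal_gen free_algebra (lin_relators s)"

section \<open>Cocommutative coalgebras\<close>

text \<open>
  The list \<open>comult C x = [(y\<^sub>1, z\<^sub>1), \<dots>, (y\<^sub>n, z\<^sub>n)]\<close> is a chosen representative of the element
  \<open>y\<^sub>1 \<otimes> z\<^sub>1 + \<dots> + y\<^sub>n \<otimes> z\<^sub>n = x\<^sub>(\<^sub>1\<^sub>) \<otimes> x\<^sub>(\<^sub>2\<^sub>)\<close> of \<open>C \<otimes> C\<close>. Identities in \<open>C \<otimes> C\<close> and \<open>C \<otimes> C \<otimes> C\<close> are stated
  in the tensor algebra of \<open>C\<close>, of which these spaces are the homogeneous components of degree two
  and three; they do not depend on the chosen representatives. The same is true of every Sweedler
  sum \<open>\<Sum>(y, z)\<leftarrow>comult C x. \<beta> y z\<close> below, since \<open>\<beta>\<close> is always bilinear.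
\<close>

record ('k, 'c) coalgebra_data =
  cscale :: "'k \<Rightarrow> 'c \<Rightarrow> 'c"
  comult :: "'c \<Rightarrow> ('c \<times> 'c) list"
  counit :: "'c \<Rightarrow> 'k"

locale coalgebra =
  fixes C :: "('k::field_char_0, 'c::ab_group_add) coalgebra_data"
  assumes vector_space: "vector_space (cscale C)"
    and counit_linear: "Vector_Spaces.linear (cscale C) (*) (counit C)"
    and comult_add: "tensor_eq (cscale C)
          (\<Sum>(u, v)\<leftarrow>comult C (x + y). gen u * gen v)
          ((\<Sum>(u, v)\<leftarrow>comult C x. gen u * gen v) + (\<Sum>(u, v)\<leftarrow>comult C y. gen u * gen v))"
    and comult_scale: "tensor_eq (cscale C)
          (\<Sum>(u, v)\<leftarrow>comult C (cscale C c x). gen u * gen v)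
          (scalar c * (\<Sum>(u, v)\<leftarrow>comult C x. gen u * gen v))"
    and coassoc: "tensor_eq (cscale C)
          (\<Sum>(y, z)\<leftarrow>comult C x. \<Sum>(u, v)\<leftarrow>comult C y. gen u * gen v * gen z)
          (\<Sum>(y, z)\<leftarrow>comult C x. \<Sum>(u, v)\<leftarrow>comult C z. gen y * gen u * gen v)"
    and counit_left: "(\<Sum>(y, z)\<leftarrow>comult C x. cscale C (counit C y) z) = x"
    and counit_right: "(\<Sum>(y, z)\<leftarrow>comult C x. cscale C (counit C z) y) = x"

locale cocommutative_coalgebra = coalgebra C
  for C :: "('k::field_char_0, 'c::ab_group_add) coalgebra_data" +
  assumes cocommutative: "tensor_eq (cscale C)
          (\<Sum>(y, z)\<leftarrow>comult C x. gen y * gen z) (\<Sum>(y, z)\<leftarrow>comult C x. gen z * gen y)"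

section \<open>Lie-Rinehart algebras\<close>

text \<open>
  Direct summands of free modules. If \<open>M\<close> is a retract of some free module, then the canonical
  surjection from the free module on the underlying set of \<open>M\<close> splits, so it suffices to consider
  that free module. The sort \<open>{comm_ring, comm_monoid_mult}\<close> (rather than \<open>comm_ring_1\<close>, which is used
  by the type-based module library) is that of all commutative rings with unit, including the zero
  ring.
\<close>

definition projective_module :: "('r::{comm_ring, comm_monoid_mult} \<Rightarrow> 'm::ab_group_add \<Rightarrow> 'm) \<Rightarrow> bool" where
  "projective_module act \<longleftrightarrow> (\<exists>(i :: 'm \<Rightarrow> ('m \<Rightarrow>\<^sub>0 'r)) (p :: ('m \<Rightarrow>\<^sub>0 'r) \<Rightarrow> 'm).
     (\<forall>x y. i (x + y) = i x + i y) \<and> (\<forall>r x. i (act r x) = Poly_Mapping.map ((*) r) (i x)) \<and>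
     (\<forall>u v. p (u + v) = p u + p v) \<and> (\<forall>r u. p (Poly_Mapping.map ((*) r) u) = act r (p u)) \<and>
     (\<forall>x. p (i x) = x))"

record ('k, 'r, 'l) lie_rinehart_data =
  rscale :: "'k \<Rightarrow> 'r \<Rightarrow> 'r"
  lscale :: "'k \<Rightarrow> 'l \<Rightarrow> 'l"
  ract :: "'r \<Rightarrow> 'l \<Rightarrow> 'l"
  lbracket :: "'l \<Rightarrow> 'l \<Rightarrow> 'l"
  anchor :: "'l \<Rightarrow> 'r \<Rightarrow> 'r"
  conn :: "'l \<Rightarrow> 'r \<Rightarrow> 'r"

locale lie_rinehart =
  fixes A :: "('k::field_char_0, 'r::{comm_ring, comm_monoid_mult}, 'l::ab_group_add) lie_rinehart_data"
  assumes rscale_vector_space: "vector_space (rscale A)"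
    and rscale_mult: "rscale A c (r * r') = rscale A c r * r'"
    and lscale_vector_space: "vector_space (lscale A)"
    and ract_add_right: "ract A r (Z + Z') = ract A r Z + ract A r Z'"
    and ract_add_left: "ract A (r + r') Z = ract A r Z + ract A r' Z"
    and ract_mult: "ract A (r * r') Z = ract A r (ract A r' Z)"
    and ract_one: "ract A 1 Z = Z"
    and ract_rscale: "ract A (rscale A c r) Z = lscale A c (ract A r Z)"
    and projective: "projective_module (ract A)"
    and lbracket_linear_right: "Vector_Spaces.linear (lscale A) (lscale A) (\<lambda>Z'. lbracket A Z Z')"
    and lbracket_linear_left: "Vector_Spaces.linear (lscale A) (lscale A) (\<lambda>Z. lbracket A Z Z')"
    and lbracket_self: "lbracket A Z Z = 0"
    and jacobi: "lbracket A X (lbracket A Y Z) + lbracket A Y (lbracket A Z X)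
                   + lbracket A Z (lbracket A X Y) = 0"
    and anchor_linear_right: "Vector_Spaces.linear (rscale A) (rscale A) (anchor A Z)"
    and anchor_derivation: "anchor A Z (r * r') = anchor A Z r * r' + r * anchor A Z r'"
    and anchor_linear_left: "Vector_Spaces.linear (lscale A) (rscale A) (\<lambda>Z. anchor A Z r)"
    and anchor_lbracket: "anchor A (lbracket A Z Z') r
                            = anchor A Z (anchor A Z' r) - anchor A Z' (anchor A Z r)"
    and anchor_ract: "anchor A (ract A r Z) r' = r * anchor A Z r'"
    and lbracket_ract: "lbracket A Z (ract A r Z')
                          = ract A r (lbracket A Z Z') + ract A (anchor A Z r) Z'"
    and conn_linear_right: "Vector_Spaces.linear (rscale A) (rscale A) (conn A Z)"
    and conn_linear_left: "Vector_Spaces.linear (lscale A) (rscale A) (\<lambda>Z. conn A Z r)"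
    and conn_mult: "conn A Z (r' * r) = r' * conn A Z r - anchor A Z r' * r"
    and conn_ract: "conn A (ract A r' Z) r = conn A Z (r' * r)"
    and flat: "conn A Z (conn A Z' r) - conn A Z' (conn A Z r) = conn A (lbracket A Z' Z) r"

section \<open>Measurings\<close>

text \<open>
  An element of \<open>Vect\<^sub>k(B, B')\<close> is represented by any function that restricts to it on the carrier of
  \<open>B\<close>.
\<close>

definition alg_measuring ::
  "('k::field_char_0, 'c::ab_group_add) coalgebra_data \<Rightarrow> ('k, 'a) module \<Rightarrow> ('k, 'b) module
     \<Rightarrow> ('c \<Rightarrow> 'a \<Rightarrow> 'b) \<Rightarrow> bool" where
  "alg_measuring C B B' \<phi> \<longleftrightarrow> k_algebra B \<and> k_algebra B' \<and>
    (\<forall>x. \<phi> x \<in> carrier B \<rightarrow> carrier B') \<and>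
    (\<forall>x. \<forall>a\<in>carrier B. \<forall>b\<in>carrier B. \<phi> x (a \<oplus>\<^bsub>B\<^esub> b) = \<phi> x a \<oplus>\<^bsub>B'\<^esub> \<phi> x b) \<and>
    (\<forall>x c. \<forall>a\<in>carrier B. \<phi> x (c \<odot>\<^bsub>B\<^esub> a) = c \<odot>\<^bsub>B'\<^esub> \<phi> x a) \<and>
    (\<forall>x y. \<forall>a\<in>carrier B. \<phi> (x + y) a = \<phi> x a \<oplus>\<^bsub>B'\<^esub> \<phi> y a) \<and>
    (\<forall>c x. \<forall>a\<in>carrier B. \<phi> (cscale C c x) a = c \<odot>\<^bsub>B'\<^esub> \<phi> x a) \<and>
    (\<forall>x. \<forall>a\<in>carrier B. \<forall>b\<in>carrier B. \<phi> x (a \<otimes>\<^bsub>B\<^esub> b)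
       = foldr (\<oplus>\<^bsub>B'\<^esub>) (map (\<lambda>(y, z). \<phi> y a \<otimes>\<^bsub>B'\<^esub> \<phi> z b) (comult C x)) \<zero>\<^bsub>B'\<^esub>) \<and>
    (\<forall>x. \<phi> x \<one>\<^bsub>B\<^esub> = counit C x \<odot>\<^bsub>B'\<^esub> \<one>\<^bsub>B'\<^esub>)"

definition lr_measuring ::
  "('k::field_char_0, 'c::ab_group_add) coalgebra_data
     \<Rightarrow> ('k, 'r::{comm_ring, comm_monoid_mult}, 'l::ab_group_add) lie_rinehart_data
     \<Rightarrow> ('k, 's::{comm_ring, comm_monoid_mult}, 'm::ab_group_add) lie_rinehart_data
     \<Rightarrow> ('c \<Rightarrow> 'l \<Rightarrow> 'm) \<Rightarrow> ('c \<Rightarrow> 'r \<Rightarrow> 's) \<Rightarrow> bool" where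
  "lr_measuring C A A' \<Psi> \<psi> \<longleftrightarrow>
    alg_measuring C (type_alg (rscale A)) (type_alg (rscale A')) \<psi> \<and>
    (\<forall>x. Vector_Spaces.linear (lscale A) (lscale A') (\<Psi> x)) \<and>
    (\<forall>Z. Vector_Spaces.linear (cscale C) (lscale A') (\<lambda>x. \<Psi> x Z)) \<and>
    (\<forall>x Z\<^sub>1 Z\<^sub>2. \<Psi> x (lbracket A Z\<^sub>1 Z\<^sub>2) = (\<Sum>(y, z)\<leftarrow>comult C x. lbracket A' (\<Psi> y Z\<^sub>1) (\<Psi> z Z\<^sub>2))) \<and>
    (\<forall>x Z r. \<psi> x (anchor A Z r) = (\<Sum>(y, z)\<leftarrow>comult C x. anchor A' (\<Psi> y Z) (\<psi> z r))) \<and>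
    (\<forall>x Z r. \<psi> x (conn A Z r) = (\<Sum>(y, z)\<leftarrow>comult C x. conn A' (\<Psi> y Z) (\<psi> z r))) \<and>
    (\<forall>x r Z. \<Psi> x (ract A r Z) = (\<Sum>(y, z)\<leftarrow>comult C x. ract A' (\<psi> y r) (\<Psi> z Z)))"

section \<open>Universal enveloping algebras\<close>

definition lie_enveloping ::
  "('k::field \<Rightarrow> 'g::ab_group_add \<Rightarrow> 'g) \<Rightarrow> ('g \<Rightarrow> 'g \<Rightarrow> 'g) \<Rightarrow> ('k, ('g list \<Rightarrow>\<^sub>0 'k) set) module" where
  "lie_enveloping s br = alg_quot free_algebra (ideal_gen free_algebra
     (lin_relators s \<union> {gen a * gen b - gen b * gen a - gen (br a b) | a b. True}))"

definition lie_enveloping_map ::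
  "('k::field \<Rightarrow> 'g::ab_group_add \<Rightarrow> 'g) \<Rightarrow> ('g \<Rightarrow> 'g \<Rightarrow> 'g) \<Rightarrow> 'g \<Rightarrow> ('g list \<Rightarrow>\<^sub>0 'k) set" where
  "lie_enveloping_map s br a = ideal_gen free_algebra
     (lin_relators s \<union> {gen a * gen b - gen b * gen a - gen (br a b) | a b. True})
     +>\<^bsub>free_algebra\<^esub> gen a"

context
  fixes A :: "('k::field_char_0, 'r::{comm_ring, comm_monoid_mult}, 'l::ab_group_add) lie_rinehart_data"
begin

definition sd_scale :: "'k \<Rightarrow> 'r \<times> 'l \<Rightarrow> 'r \<times> 'l" where
  "sd_scale c = (\<lambda>(r, Z). (rscale A c r, lscale A c Z))"

definition sd_bracket :: "'r \<times> 'l \<Rightarrow> 'r \<times> 'l \<Rightarrow> 'r \<times> 'l" where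
  "sd_bracket = (\<lambda>(r\<^sub>1, Z\<^sub>1) (r\<^sub>2, Z\<^sub>2). (anchor A Z\<^sub>1 r\<^sub>2 - anchor A Z\<^sub>2 r\<^sub>1, lbracket A Z\<^sub>1 Z\<^sub>2))"

definition lr_U :: "('k, (('r \<times> 'l) list \<Rightarrow>\<^sub>0 'k) set) module" where
  "lr_U = lie_enveloping sd_scale sd_bracket"

definition lr_U_map :: "'r \<times> 'l \<Rightarrow> (('r \<times> 'l) list \<Rightarrow>\<^sub>0 'k) set" where
  "lr_U_map = lie_enveloping_map sd_scale sd_bracket"

text \<open>
  As in Rinehart's construction, the subalgebra generated by the image of \<open>R \<oplus> L\<close> is the non-unital
  one (the augmentation ideal): the unit inherited from \<^const>\<open>lr_U\<close> need not lie in its carrier. Its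
  quotient has a unit, namely the class of \<open>(1, 0)\<close>.
\<close>

definition lr_Ubar :: "('k, (('r \<times> 'l) list \<Rightarrow>\<^sub>0 'k) set) module" where
  "lr_Ubar = lr_U\<lparr>carrier := subalgebra_gen lr_U (range lr_U_map)\<rparr>"

definition lr_ideal :: "(('r \<times> 'l) list \<Rightarrow>\<^sub>0 'k) set set" where
  "lr_ideal = ideal_gen lr_Ubar
     {lr_U_map (r\<^sub>1 * r\<^sub>2, ract A r\<^sub>1 Z\<^sub>2) \<ominus>\<^bsub>lr_U\<^esub> (lr_U_map (r\<^sub>1, 0) \<otimes>\<^bsub>lr_U\<^esub> lr_U_map (r\<^sub>2, Z\<^sub>2)) | r\<^sub>1 r\<^sub>2 Z\<^sub>2. True}"

definition lr_V_map :: "'r \<times> 'l \<Rightarrow> (('r \<times> 'l) list \<Rightarrow>\<^sub>0 'k) set set" where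
  "lr_V_map g = lr_ideal +>\<^bsub>lr_Ubar\<^esub> lr_U_map g"

definition lr_V :: "('k, (('r \<times> 'l) list \<Rightarrow>\<^sub>0 'k) set set) module" where
  "lr_V = (alg_quot lr_Ubar lr_ideal)\<lparr>one := lr_V_map (1, 0)\<rparr>"

end

end

theory Submission
  imports Defs
begin

text \<open>
  Modulo one two-sided ideal of the free unital algebra on \<open>R \<oplus> L\<close>, generated by the relations of a
  linear map, of the Lie bracket, of the \<open>R\<close>-module structure and \<open>(1, 0) = 1\<close>, one obtains the
  enveloping algebra \<open>V\<close>. The measuring acts on words by
  \<open>x(a\<^sub>1 \<cdots> a\<^sub>n) = x\<^sub>(\<^sub>1\<^sub>)(a\<^sub>1) \<cdots> x\<^sub>(\<^sub>n\<^sub>)(a\<^sub>n)\<close>; coassociativity makes this a measuring of the free algebra into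
  \<open>V'\<close>, so that the elements killed by all \<open>x\<close> form a two-sided ideal. This ideal contains the
  relators: those of the bracket because \<open>C\<close> is cocommutative, the others because \<open>(\<Psi>, \<psi>)\<close> is a
  measuring.
\<close>

section \<open>Free algebras modulo an ideal\<close>

lemma type_alg_simps [simp]:
  "carrier (type_alg s) = UNIV" "x \<otimes>\<^bsub>type_alg s\<^esub> y = x * y" "\<one>\<^bsub>type_alg s\<^esub> = 1"
  "\<zero>\<^bsub>type_alg s\<^esub> = 0" "x \<oplus>\<^bsub>type_alg s\<^esub> y = x + y" "c \<odot>\<^bsub>type_alg s\<^esub> x = s c x"
  by (simp_all add: type_alg_def)

lemma free_algebra_simps [simp]:
  "carrier free_algebra = UNIV" "x \<otimes>\<^bsub>free_algebra\<^esub> y = x * y"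
  "\<zero>\<^bsub>free_algebra\<^esub> = 0" "x \<oplus>\<^bsub>free_algebra\<^esub> y = x + y" "c \<odot>\<^bsub>free_algebra\<^esub> x = scalar c * x"
  by (simp_all add: free_algebra_def)

definition word :: "'a list \<Rightarrow> 'a list \<Rightarrow>\<^sub>0 'k::field" where
  "word w = Poly_Mapping.single w 1"

lemma word_Nil [simp]: "word [] = 1"
  by (simp add: word_def flip: zero_list_def)

lemma word_append: "word (u @ w) = word u * word w"
  by (simp add: word_def mult_single plus_list_def)

lemma word_Cons: "word (a # w) = gen a * word w"
  by (simp add: word_def gen_def mult_single plus_list_def)

lemma word_single [simp]: "word [a] = gen a"
  by (simp add: word_def gen_def)

lemma scalar_0 [simp]: "scalar 0 = 0"
  by (simp add: scalar_def)

lemma scalar_1 [simp]: "scalar 1 = 1"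
  by (simp add: scalar_def)

lemma scalar_add: "scalar (c + d) = scalar c + scalar d"
  by (simp add: scalar_def single_add)

lemma scalar_mult: "scalar (c * d) = scalar c * scalar d"
  by (simp add: scalar_def mult_single)

lemma scalar_minus_1 [simp]: "scalar (- 1) = - 1"
  by (simp add: scalar_def single_uminus)

lemma single_eq_scalar_word: "Poly_Mapping.single w c = scalar c * word w"
  by (simp add: scalar_def word_def mult_single)

lemma free_algebra_induct [case_names add scalar_word]:
  assumes "\<And>p q. P p \<Longrightarrow> P q \<Longrightarrow> P (p + q)"
    and "\<And>c w. P (scalar c * word w)"
  shows "P p"
proof (induction p rule: update_induct)
  case const
  show ?case using assms(2)[of 0] by simp
next
  case (update f k v)
  have "Poly_Mapping.update k v f = f + Poly_Mapping.single k v"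
    using update(1)
    by (intro poly_mapping_eqI) (auto simp: lookup_update lookup_add lookup_single in_keys_iff when_def)
  with update assms show ?case by (simp add: single_eq_scalar_word)
qed

lemma mult_scalar_commute: "p * scalar c = scalar c * p"
proof (induction p rule: free_algebra_induct)
  case (scalar_word d w)
  show ?case
    by (simp add: scalar_def word_def mult_single mult.commute)
qed (simp add: algebra_simps)

lemma mult_scalar_left_commute: "p * (scalar c * q) = scalar c * (p * q)"
  by (metis mult.assoc mult_scalar_commute)

definition mod_eq :: "('a list \<Rightarrow>\<^sub>0 'k::field) set \<Rightarrow> ('a list \<Rightarrow>\<^sub>0 'k) \<Rightarrow> ('a list \<Rightarrow>\<^sub>0 'k) \<Rightarrow> bool" where
  "mod_eq S p q \<longleftrightarrow> p - q \<in> ideal_gen free_algebra S"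

lemmas ideal_gen_free = ideal_gen.intros[where B = free_algebra, simplified]

lemma ideal_gen_free_uminus: "p \<in> ideal_gen free_algebra S \<Longrightarrow> - p \<in> ideal_gen free_algebra S"
  using ideal_gen_free(4)[of p S "- 1"] by simp

lemma mod_eq_base: "p - q \<in> S \<Longrightarrow> mod_eq S p q"
  by (simp add: mod_eq_def ideal_gen_free)

lemma mod_eq_refl [simp, intro]: "mod_eq S p p"
  by (simp add: mod_eq_def ideal_gen_free)

lemma mod_eq_sym: "mod_eq S p q \<Longrightarrow> mod_eq S q p"
  using ideal_gen_free_uminus[of "p - q" S] by (simp add: mod_eq_def)

lemma mod_eq_trans [trans]: "mod_eq S p q \<Longrightarrow> mod_eq S q r \<Longrightarrow> mod_eq S p r"
  using ideal_gen_free(3)[of "p - q" S "q - r"] by (simp add: mod_eq_def)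

lemma mod_eq_add: "mod_eq S p q \<Longrightarrow> mod_eq S p' q' \<Longrightarrow> mod_eq S (p + p') (q + q')"
  using ideal_gen_free(3)[of "p - q" S "p' - q'"] by (simp add: mod_eq_def algebra_simps)

lemma mod_eq_mult_left: "mod_eq S p q \<Longrightarrow> mod_eq S (b * p) (b * q)"
  using ideal_gen_free(5)[of "p - q" S b] by (simp add: mod_eq_def algebra_simps)

lemma mod_eq_mult_right: "mod_eq S p q \<Longrightarrow> mod_eq S (p * b) (q * b)"
  using ideal_gen_free(6)[of "p - q" S b] by (simp add: mod_eq_def algebra_simps)

lemma mod_eq_mult: "mod_eq S p q \<Longrightarrow> mod_eq S p' q' \<Longrightarrow> mod_eq S (p * p') (q * q')"
  by (meson mod_eq_mult_left mod_eq_mult_right mod_eq_trans)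

lemma mod_eq_uminus: "mod_eq S p q \<Longrightarrow> mod_eq S (- p) (- q)"
  using mod_eq_mult_left[of S p q "- 1"] by simp

lemma mod_eq_diff: "mod_eq S p q \<Longrightarrow> mod_eq S p' q' \<Longrightarrow> mod_eq S (p - p') (q - q')"
  using mod_eq_add[OF _ mod_eq_uminus] by fastforce

lemma mod_eq_sum_list:
  "(\<And>x y. mod_eq S (f x y) (h x y)) \<Longrightarrow> mod_eq S (\<Sum>(x, y)\<leftarrow>l. f x y) (\<Sum>(x, y)\<leftarrow>l. h x y)"
  by (induction l) (auto intro: mod_eq_add)

lemma mod_eq_sum_list_0:
  assumes "\<And>x y. mod_eq S (f x y) 0"
  shows "mod_eq S (\<Sum>(x, y)\<leftarrow>l. f x y) 0"
  using mod_eq_sum_list[where h = "\<lambda>x y. 0" and S = S, of f l] assms by (simp add: split_def)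

lemma mod_eq_mult_add_left: "mod_eq S p (p' + p'') \<Longrightarrow> mod_eq S (p * q) (p' * q + p'' * q)"
  using mod_eq_mult_right[of S p "p' + p''" q] by (simp add: distrib_right)

lemma mod_eq_mult_add_right: "mod_eq S q (q' + q'') \<Longrightarrow> mod_eq S (p * q) (p * q' + p * q'')"
  using mod_eq_mult_left[of S q "q' + q''" p] by (simp add: distrib_left)

lemma mod_eq_mult_scalar_left: "mod_eq S p (scalar c * p') \<Longrightarrow> mod_eq S (p * q) (scalar c * (p' * q))"
  using mod_eq_mult_right[of S p "scalar c * p'" q] by (simp add: mult.assoc)

lemma mod_eq_mult_scalar_right: "mod_eq S q (scalar c * q') \<Longrightarrow> mod_eq S (p * q) (scalar c * (p * q'))"
  using mod_eq_mult_left[of S q "scalar c * q'" p] by (simp add: mult_scalar_left_commute)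

lemma mod_eq_mono:
  assumes "S \<subseteq> T" "mod_eq S p q"
  shows "mod_eq T p q"
proof -
  have "x \<in> ideal_gen free_algebra T" if "x \<in> ideal_gen free_algebra S" for x
    using that by induction (use assms(1) in \<open>auto intro: ideal_gen_free\<close>)
  with assms(2) show ?thesis by (simp add: mod_eq_def)
qed

subsection \<open>Linear extension from words\<close>

definition lin_ext :: "('a list \<Rightarrow> 'b list \<Rightarrow>\<^sub>0 'k) \<Rightarrow> ('a list \<Rightarrow>\<^sub>0 'k) \<Rightarrow> 'b list \<Rightarrow>\<^sub>0 'k::field" where
  "lin_ext t p = (\<Sum>w\<in>Poly_Mapping.keys p. scalar (Poly_Mapping.lookup p w) * t w)"

lemma lin_ext_add: "lin_ext t (p + q) = lin_ext t p + lin_ext t q"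
  unfolding lin_ext_def
  by (intro setsum_keys_plus_distrib) (simp_all add: scalar_add algebra_simps)

lemma lin_ext_0 [simp]: "lin_ext t 0 = 0"
  by (simp add: lin_ext_def)

lemma lin_ext_word_scalar: "lin_ext t (scalar c * word w) = scalar c * t w"
  by (simp add: lin_ext_def flip: single_eq_scalar_word)

lemma lin_ext_word [simp]: "lin_ext t (word w) = t w"
  using lin_ext_word_scalar[of t 1] by simp

lemma lin_ext_scalar: "lin_ext t (scalar c * p) = scalar c * lin_ext t p"
proof (induction p rule: free_algebra_induct)
  case (scalar_word d w)
  show ?case
    using lin_ext_word_scalar[of t "c * d" w] lin_ext_word_scalar[of t d w]
    by (simp add: scalar_mult mult.assoc)
qed (simp add: lin_ext_add algebra_simps)

lemma lin_ext_uminus: "lin_ext t (- p) = - lin_ext t p"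
  using lin_ext_scalar[of t "- 1" p] by simp

lemma lin_ext_diff: "lin_ext t (p - q) = lin_ext t p - lin_ext t q"
  using lin_ext_add[of t p "- q"] by (simp add: lin_ext_uminus)

lemma lin_ext_sum_list:
  "lin_ext t (\<Sum>(x, y)\<leftarrow>l. f x y) = (\<Sum>(x, y)\<leftarrow>l. lin_ext t (f x y))"
  by (induction l) (auto simp: lin_ext_add)

lemma lin_ext_ideal:
  assumes "\<And>s u w. s \<in> R \<Longrightarrow> lin_ext t (word u * s * word w) \<in> ideal_gen free_algebra S"
    and "p \<in> ideal_gen free_algebra R"
  shows "lin_ext t p \<in> ideal_gen free_algebra S"
proof -
  have "lin_ext t (b * p * b') \<in> ideal_gen free_algebra S" for b b'
    using assms(2)
  proof (induction arbitrary: b b')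
    case (1 s)
    show ?case
    proof (induction b rule: free_algebra_induct)
      case (scalar_word c u)
      show ?case
      proof (induction b' rule: free_algebra_induct)
        case (scalar_word d w)
        have "scalar c * word u * s * (scalar d * word w) =
            scalar c * (scalar d * (word u * s * word w))"
          by (metis mult.assoc mult_scalar_left_commute)
        then show ?case
          using assms(1)[OF 1, of u w] by (simp only: lin_ext_scalar ideal_gen_free)
      qed (simp add: distrib_left lin_ext_add ideal_gen_free)
    qed (simp add: distrib_right lin_ext_add ideal_gen_free)
  next
    case (4 x c)
    have "b * (scalar c * x) * b' = scalar c * (b * x * b')"
      by (metis mult.assoc mult_scalar_left_commute)
    with 4 show ?case by (simp only: lin_ext_scalar ideal_gen_free free_algebra_simps)
  next
    case (5 x d)
    then show ?case using "5.IH"[of "b * d" b'] by (simp add: mult.assoc)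
  next
    case (6 x d)
    then show ?case using "6.IH"[of b "d * b'"] by (simp add: mult.assoc)
  qed (simp_all add: distrib_left distrib_right lin_ext_add ideal_gen_free)
  from this[of 1 1] show ?thesis by simp
qed

lemma lin_ext_tensor_eq:
  assumes add: "\<And>u w a b. mod_eq S (t (u @ (a + b) # w)) (t (u @ a # w) + t (u @ b # w))"
    and scale: "\<And>u w c a. mod_eq S (t (u @ s c a # w)) (scalar c * t (u @ a # w))"
    and "tensor_eq s p q"
  shows "mod_eq S (lin_ext t p) (lin_ext t q)"
proof -
  have word_gen_word: "word u * gen a * word w = word (u @ a # w)" for u w and a :: 'a
    by (simp add: word_append word_Cons mult.assoc)
  have "lin_ext t (p - q) \<in> ideal_gen free_algebra S"
  proof (rule lin_ext_ideal)
    show "p - q \<in> ideal_gen free_algebra (lin_relators s)"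
      using assms(3) by (simp add: tensor_eq_def)
    fix x u w
    assume "x \<in> lin_relators s"
    then consider a b where "x = gen (a + b) - gen a - gen b"
      | c a where "x = gen (s c a) - scalar c * gen a"
      by (auto simp: lin_relators_def)
    then show "lin_ext t (word u * x * word w) \<in> ideal_gen free_algebra S"
    proof cases
      case 1
      have "word u * x * word w = word (u @ (a + b) # w) - (word (u @ a # w) + word (u @ b # w))"
        by (simp add: 1 algebra_simps flip: word_gen_word)
      then show ?thesis
        using add[of u a b w] by (simp only: lin_ext_diff lin_ext_add lin_ext_word mod_eq_def)
    next
      case 2
      have "word u * x * word w = word (u @ s c a # w) - scalar c * word (u @ a # w)"
        by (simp add: 2 left_diff_distrib right_diff_distrib mult_scalar_left_commute mult.assoc
            flip: word_gen_word)
      then show ?thesis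
        using scale[of u c a w] by (simp add: lin_ext_diff lin_ext_scalar mod_eq_def)
    qed
  qed
  then show ?thesis by (simp add: mod_eq_def lin_ext_diff)
qed

lemma bilinear_tensor_eq:
  fixes \<beta> :: "'a::ab_group_add \<Rightarrow> 'a \<Rightarrow> 'b list \<Rightarrow>\<^sub>0 'k::field"
  assumes "\<And>x x' y. mod_eq S (\<beta> (x + x') y) (\<beta> x y + \<beta> x' y)"
    and "\<And>x y y'. mod_eq S (\<beta> x (y + y')) (\<beta> x y + \<beta> x y')"
    and "\<And>c x y. mod_eq S (\<beta> (s c x) y) (scalar c * \<beta> x y)"
    and "\<And>c x y. mod_eq S (\<beta> x (s c y)) (scalar c * \<beta> x y)"
    and "tensor_eq s p q"
  shows "mod_eq S (lin_ext (\<lambda>w. case w of [x, y] \<Rightarrow> \<beta> x y | _ \<Rightarrow> 0) p)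
    (lin_ext (\<lambda>w. case w of [x, y] \<Rightarrow> \<beta> x y | _ \<Rightarrow> 0) q)"
  by (rule lin_ext_tensor_eq[OF _ _ assms(5)])
    (auto simp: assms(1-4) append_eq_Cons_conv Cons_eq_append_conv split: list.splits)

lemma trilinear_tensor_eq:
  fixes \<gamma> :: "'a::ab_group_add \<Rightarrow> 'a \<Rightarrow> 'a \<Rightarrow> 'b list \<Rightarrow>\<^sub>0 'k::field"
  assumes "\<And>x x' y z. mod_eq S (\<gamma> (x + x') y z) (\<gamma> x y z + \<gamma> x' y z)"
    and "\<And>x y y' z. mod_eq S (\<gamma> x (y + y') z) (\<gamma> x y z + \<gamma> x y' z)"
    and "\<And>x y z z'. mod_eq S (\<gamma> x y (z + z')) (\<gamma> x y z + \<gamma> x y z')"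
    and "\<And>c x y z. mod_eq S (\<gamma> (s c x) y z) (scalar c * \<gamma> x y z)"
    and "\<And>c x y z. mod_eq S (\<gamma> x (s c y) z) (scalar c * \<gamma> x y z)"
    and "\<And>c x y z. mod_eq S (\<gamma> x y (s c z)) (scalar c * \<gamma> x y z)"
    and "tensor_eq s p q"
  shows "mod_eq S (lin_ext (\<lambda>w. case w of [x, y, z] \<Rightarrow> \<gamma> x y z | _ \<Rightarrow> 0) p)
    (lin_ext (\<lambda>w. case w of [x, y, z] \<Rightarrow> \<gamma> x y z | _ \<Rightarrow> 0) q)"
  by (rule lin_ext_tensor_eq[OF _ _ assms(7)])
    (auto simp: assms(1-6) append_eq_Cons_conv Cons_eq_append_conv split: list.splits)

lemma lin_ext_gen_gen [simp]: "lin_ext t (gen a * gen b) = t [a, b]"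
  using lin_ext_word[of t "[a, b]"] by (simp add: word_Cons)

lemma lin_ext_gen_gen_gen [simp]: "lin_ext t (gen a * gen b * gen c) = t [a, b, c]"
  using lin_ext_word[of t "[a, b, c]"] by (simp add: word_Cons mult.assoc)

section \<open>The measuring of free algebras induced by a bilinear map\<close>

primrec word_act ::
  "('k::field, 'c::ab_group_add) coalgebra_data \<Rightarrow> ('c \<Rightarrow> 'a \<Rightarrow> 'b) \<Rightarrow> 'a list \<Rightarrow> 'c \<Rightarrow> 'b list \<Rightarrow>\<^sub>0 'k" where
  "word_act C g [] x = scalar (counit C x)"
| "word_act C g (a # w) x = (\<Sum>(y, z)\<leftarrow>comult C x. gen (g y a) * word_act C g w z)"

definition free_act ::
  "('k::field, 'c::ab_group_add) coalgebra_data \<Rightarrow> ('c \<Rightarrow> 'a \<Rightarrow> 'b) \<Rightarrow> 'c \<Rightarrow> ('a list \<Rightarrow>\<^sub>0 'k) \<Rightarrow> 'b list \<Rightarrow>\<^sub>0 'k" where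
  "free_act C g x = lin_ext (\<lambda>w. word_act C g w x)"

context coalgebra
begin

lemma counit_add: "counit C (x + y) = counit C x + counit C y"
  and counit_scale: "counit C (cscale C c x) = c * counit C x"
  using counit_linear
  unfolding Vector_Spaces.linear_def module_hom_def module_hom_axioms_def by auto

lemma sum_comult_add:
  assumes "\<And>x x' y. mod_eq S (\<beta> (x + x') y) (\<beta> x y + \<beta> x' y)"
    and "\<And>x y y'. mod_eq S (\<beta> x (y + y')) (\<beta> x y + \<beta> x y')"
    and "\<And>c x y. mod_eq S (\<beta> (cscale C c x) y) (scalar c * \<beta> x y)"
    and "\<And>c x y. mod_eq S (\<beta> x (cscale C c y)) (scalar c * \<beta> x y)"
  shows "mod_eq S (\<Sum>(y, z)\<leftarrow>comult C (u + v). \<beta> y z)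
    ((\<Sum>(y, z)\<leftarrow>comult C u. \<beta> y z) + (\<Sum>(y, z)\<leftarrow>comult C v. \<beta> y z))"
  using bilinear_tensor_eq[OF assms comult_add, of u v] by (simp add: lin_ext_add lin_ext_sum_list)

lemma sum_comult_scale:
  assumes "\<And>x x' y. mod_eq S (\<beta> (x + x') y) (\<beta> x y + \<beta> x' y)"
    and "\<And>x y y'. mod_eq S (\<beta> x (y + y')) (\<beta> x y + \<beta> x y')"
    and "\<And>c x y. mod_eq S (\<beta> (cscale C c x) y) (scalar c * \<beta> x y)"
    and "\<And>c x y. mod_eq S (\<beta> x (cscale C c y)) (scalar c * \<beta> x y)"
  shows "mod_eq S (\<Sum>(y, z)\<leftarrow>comult C (cscale C d u). \<beta> y z)
    (scalar d * (\<Sum>(y, z)\<leftarrow>comult C u. \<beta> y z))"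
  using bilinear_tensor_eq[OF assms comult_scale, of d u] by (simp add: lin_ext_scalar lin_ext_sum_list)

lemma sum_comult_assoc:
  assumes "\<And>x x' y z. mod_eq S (\<gamma> (x + x') y z) (\<gamma> x y z + \<gamma> x' y z)"
    and "\<And>x y y' z. mod_eq S (\<gamma> x (y + y') z) (\<gamma> x y z + \<gamma> x y' z)"
    and "\<And>x y z z'. mod_eq S (\<gamma> x y (z + z')) (\<gamma> x y z + \<gamma> x y z')"
    and "\<And>c x y z. mod_eq S (\<gamma> (cscale C c x) y z) (scalar c * \<gamma> x y z)"
    and "\<And>c x y z. mod_eq S (\<gamma> x (cscale C c y) z) (scalar c * \<gamma> x y z)"
    and "\<And>c x y z. mod_eq S (\<gamma> x y (cscale C c z)) (scalar c * \<gamma> x y z)"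
  shows "mod_eq S (\<Sum>(y, z)\<leftarrow>comult C x. \<Sum>(u, v)\<leftarrow>comult C y. \<gamma> u v z)
    (\<Sum>(y, z)\<leftarrow>comult C x. \<Sum>(u, v)\<leftarrow>comult C z. \<gamma> y u v)"
  using trilinear_tensor_eq[OF assms coassoc, of x] by (simp add: lin_ext_sum_list)

end

lemma (in cocommutative_coalgebra) sum_comult_commute:
  assumes "\<And>x x' y. mod_eq S (\<beta> (x + x') y) (\<beta> x y + \<beta> x' y)"
    and "\<And>x y y'. mod_eq S (\<beta> x (y + y')) (\<beta> x y + \<beta> x y')"
    and "\<And>c x y. mod_eq S (\<beta> (cscale C c x) y) (scalar c * \<beta> x y)"
    and "\<And>c x y. mod_eq S (\<beta> x (cscale C c y)) (scalar c * \<beta> x y)"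
  shows "mod_eq S (\<Sum>(y, z)\<leftarrow>comult C x. \<beta> y z) (\<Sum>(y, z)\<leftarrow>comult C x. \<beta> z y)"
  using bilinear_tensor_eq[OF assms cocommutative, of x] by (simp add: lin_ext_sum_list)

locale bilinear_action = coalgebra C
  for C :: "('k::field_char_0, 'c::ab_group_add) coalgebra_data" +
  fixes sA :: "'k \<Rightarrow> 'a::ab_group_add \<Rightarrow> 'a"
    and sB :: "'k \<Rightarrow> 'b::ab_group_add \<Rightarrow> 'b"
    and g :: "'c \<Rightarrow> 'a \<Rightarrow> 'b"
    and S :: "('b list \<Rightarrow>\<^sub>0 'k) set"
  assumes lin_relators_subset: "lin_relators sB \<subseteq> S"
    and add_right: "g x (a + b) = g x a + g x b"
    and scale_right: "g x (sA c a) = sB c (g x a)"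
    and add_left: "g (x + y) a = g x a + g y a"
    and scale_left: "g (cscale C c x) a = sB c (g x a)"
begin

lemma mod_eq_gen_add: "mod_eq S (gen (a + b)) (gen a + gen b)"
  by (intro mod_eq_base subsetD[OF lin_relators_subset]) (auto simp: lin_relators_def diff_diff_eq)

lemma mod_eq_gen_scale: "mod_eq S (gen (sB c a)) (scalar c * gen a)"
  by (intro mod_eq_base subsetD[OF lin_relators_subset]) (auto simp: lin_relators_def)

lemma mod_eq_gen_0: "mod_eq S (gen 0) 0"
  using mod_eq_diff[OF mod_eq_gen_add[of 0 0] mod_eq_refl[of S "gen 0"]] by (auto dest: mod_eq_sym)

lemma mod_eq_gen_diff: "mod_eq S (gen (a - b)) (gen a - gen b)"
  using mod_eq_diff[OF mod_eq_gen_add[of "a - b" b] mod_eq_refl[of S "gen b"]]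
  by (simp add: mod_eq_sym)

lemma mod_eq_gen_sum_list: "mod_eq S (gen (\<Sum>(y, z)\<leftarrow>l. f y z)) (\<Sum>(y, z)\<leftarrow>l. gen (f y z))"
proof (induction l)
  case (Cons yz l)
  then show ?case
    using mod_eq_trans[OF mod_eq_gen_add mod_eq_add[OF mod_eq_refl Cons.IH]] by (cases yz) simp
qed (simp add: mod_eq_gen_0)

lemmas bilinear_intros = mod_eq_mult_add_left mod_eq_mult_add_right mod_eq_mult_scalar_left
  mod_eq_mult_scalar_right mod_eq_gen_add mod_eq_gen_scale

lemma word_act_bilinear:
  shows word_act_add: "mod_eq S (word_act C g w (x + y)) (word_act C g w x + word_act C g w y)"
    and word_act_scale: "mod_eq S (word_act C g w (cscale C c x)) (scalar c * word_act C g w x)"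
proof (induction w arbitrary: x y c)
  case Nil
  { case 1 show ?case by (simp add: counit_add scalar_add) }
  { case 2 show ?case by (simp add: counit_scale scalar_mult) }
next
  case (Cons a w)
  { case 1 show ?case
      unfolding word_act.simps
      by (rule sum_comult_add) (simp_all add: bilinear_intros Cons.IH add_left scale_left) }
  { case 2 show ?case
      unfolding word_act.simps
      by (rule sum_comult_scale) (simp_all add: bilinear_intros Cons.IH add_left scale_left) }
qed

lemma word_act_sum_list:
  "mod_eq S (word_act C g w (\<Sum>(y, z)\<leftarrow>l. cscale C (f y z) (h y z)))
    (\<Sum>(y, z)\<leftarrow>l. scalar (f y z) * word_act C g w (h y z))"
proof (induction l)
  case Nil
  then show ?case
    using mod_eq_diff[OF word_act_add[of w 0 0] mod_eq_refl[of S "word_act C g w 0"]]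
    by (auto dest: mod_eq_sym)
next
  case (Cons yz l)
  obtain y z where "yz = (y, z)" by force
  then show ?case
    using mod_eq_trans[OF word_act_add mod_eq_add[OF word_act_scale Cons.IH]] by simp
qed

lemma word_act_append:
  "mod_eq S (word_act C g (u @ w) x) (\<Sum>(y, z)\<leftarrow>comult C x. word_act C g u y * word_act C g w z)"
proof (induction u arbitrary: x)
  case Nil
  show ?case
    using word_act_sum_list[of w "\<lambda>y z. counit C y" "\<lambda>y z. z" "comult C x"] counit_left[of x]
    by simp
next
  case (Cons a u)
  have "mod_eq S (word_act C g ((a # u) @ w) x)
      (\<Sum>(y, z)\<leftarrow>comult C x. gen (g y a) *
        (\<Sum>(p, q)\<leftarrow>comult C z. word_act C g u p * word_act C g w q))"
    unfolding append_Cons word_act.simps by (intro mod_eq_sum_list mod_eq_mult_left Cons.IH)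
  also have "\<dots> = (\<Sum>(y, z)\<leftarrow>comult C x. \<Sum>(p, q)\<leftarrow>comult C z.
        gen (g y a) * word_act C g u p * word_act C g w q)"
    by (simp add: sum_list_const_mult[symmetric] split_def mult.assoc)
  also have "mod_eq S \<dots> (\<Sum>(y, z)\<leftarrow>comult C x. \<Sum>(p, q)\<leftarrow>comult C y.
        gen (g p a) * word_act C g u q * word_act C g w z)"
    by (rule mod_eq_sym, rule sum_comult_assoc)
      (simp_all add: bilinear_intros word_act_bilinear add_left scale_left)
  also have "\<dots> = (\<Sum>(y, z)\<leftarrow>comult C x. word_act C g (a # u) y * word_act C g w z)"
    by (simp add: sum_list_mult_const[symmetric] split_def)
  finally show ?case .
qed

lemma free_act_add: "free_act C g x (p + q) = free_act C g x p + free_act C g x q"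
  and free_act_diff: "free_act C g x (p - q) = free_act C g x p - free_act C g x q"
  and free_act_scalar: "free_act C g x (scalar c * p) = scalar c * free_act C g x p"
  and free_act_word: "free_act C g x (word w) = word_act C g w x"
  by (simp_all add: free_act_def lin_ext_add lin_ext_diff lin_ext_scalar)

lemma free_act_0: "free_act C g x 0 = 0"
  by (simp add: free_act_def)

lemma free_act_1: "free_act C g x 1 = scalar (counit C x)"
  using free_act_word[of x "[]"] by simp

lemma free_act_add_left: "mod_eq S (free_act C g (x + y) p) (free_act C g x p + free_act C g y p)"
proof (induction p rule: free_algebra_induct)
  case (add p q)
  then show ?case
    using mod_eq_add[OF add] by (simp add: free_act_add algebra_simps)
next
  case (scalar_word c w)
  show ?case
    using mod_eq_mult_left[OF word_act_add] by (simp add: free_act_scalar free_act_word distrib_left[symmetric])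
qed

lemma free_act_scale_left: "mod_eq S (free_act C g (cscale C c x) p) (scalar c * free_act C g x p)"
proof (induction p rule: free_algebra_induct)
  case (add p q)
  then show ?case
    using mod_eq_add[OF add] by (simp add: free_act_add algebra_simps)
next
  case (scalar_word d w)
  have "scalar c * (scalar d * word_act C g w x) = scalar d * (scalar c * word_act C g w x)"
    by (rule mult_scalar_left_commute)
  then show ?case
    using mod_eq_mult_left[OF word_act_scale] by (simp add: free_act_scalar free_act_word)
qed

lemma free_act_mult:
  "mod_eq S (free_act C g x (p * q)) (\<Sum>(y, z)\<leftarrow>comult C x. free_act C g y p * free_act C g z q)"
proof (induction p rule: free_algebra_induct)
  case (add p p')
  show ?case
    using mod_eq_add[OF add] by (simp add: free_act_add distrib_right sum_list_addf split_def)
next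
  case (scalar_word c u)
  show ?case
  proof (induction q rule: free_algebra_induct)
    case (add q q')
    show ?case
      using mod_eq_add[OF add] by (simp add: free_act_add distrib_left sum_list_addf split_def)
  next
    case (scalar_word d w)
    have "scalar c * word u * (scalar d * word w) = scalar c * (scalar d * word (u @ w))"
      by (metis mult.assoc mult_scalar_left_commute word_append)
    moreover have "scalar c * p * (scalar d * q) = scalar c * (scalar d * (p * q))"
      for p q :: "'b list \<Rightarrow>\<^sub>0 'k"
      by (metis mult.assoc mult_scalar_left_commute)
    ultimately show ?case
      using mod_eq_mult_left[OF mod_eq_mult_left[OF word_act_append]]
      by (simp add: free_act_scalar free_act_word sum_list_const_mult split_def)
  qed
qed

lemma free_act_gen: "mod_eq S (free_act C g x (gen a)) (gen (g x a))"
proof -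
  have g_0: "g 0 a = 0" using add_left[of 0 0 a] by simp
  have "g (\<Sum>(y, z)\<leftarrow>l. cscale C (counit C z) y) a = (\<Sum>(y, z)\<leftarrow>l. sB (counit C z) (g y a))" for l
    by (induction l) (auto simp: add_left scale_left g_0)
  from this[of "comult C x"] have "gen (g x a) = gen (\<Sum>(y, z)\<leftarrow>comult C x. sB (counit C z) (g y a))"
    by (simp add: counit_right)
  also have "mod_eq S \<dots> (\<Sum>(y, z)\<leftarrow>comult C x. gen (sB (counit C z) (g y a)))"
    by (rule mod_eq_gen_sum_list)
  also have "mod_eq S \<dots> (\<Sum>(y, z)\<leftarrow>comult C x. scalar (counit C z) * gen (g y a))"
    by (intro mod_eq_sum_list mod_eq_gen_scale)
  also have "\<dots> = free_act C g x (gen a)"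
    using free_act_word[of x "[a]"] by (simp add: mult_scalar_commute)
  finally show ?thesis by (rule mod_eq_sym)
qed

lemma free_act_gen_gen:
  "mod_eq S (free_act C g x (gen a * gen b)) (\<Sum>(y, z)\<leftarrow>comult C x. gen (g y a) * gen (g z b))"
  by (rule mod_eq_trans[OF free_act_mult]) (intro mod_eq_sum_list mod_eq_mult free_act_gen)

lemma free_act_ideal:
  assumes relators: "\<And>x s. s \<in> R \<Longrightarrow> mod_eq S (free_act C g x s) 0"
    and "p \<in> ideal_gen free_algebra R"
  shows "mod_eq S (free_act C g x p) 0"
  using assms(2)
proof (induction arbitrary: x)
  case (3 p q)
  then show ?case using mod_eq_add[OF 3(3,4)] by (simp add: free_act_add)
next
  case (4 p c)
  then show ?case using mod_eq_mult_left[OF 4(2)] by (fastforce simp: free_act_scalar)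
next
  case (5 p b)
  have "mod_eq S (free_act C g y b * free_act C g z p) 0" for y z
    using mod_eq_mult_left[OF 5(3)] by fastforce
  then show ?case
    unfolding free_algebra_simps by (rule mod_eq_trans[OF free_act_mult mod_eq_sum_list_0])
next
  case (6 p b)
  have "mod_eq S (free_act C g y p * free_act C g z b) 0" for y z
    using mod_eq_mult_right[OF 6(3)] by fastforce
  then show ?case
    unfolding free_algebra_simps by (rule mod_eq_trans[OF free_act_mult mod_eq_sum_list_0])
qed (simp_all add: relators free_act_0)

lemma free_act_cong:
  assumes "\<And>x s. s \<in> R \<Longrightarrow> mod_eq S (free_act C g x s) 0"
    and "mod_eq R p q"
  shows "mod_eq S (free_act C g x p) (free_act C g x q)"
proof -
  have "mod_eq S (free_act C g x (p - q)) 0"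
    by (rule free_act_ideal[OF assms(1)]) (use assms(2) in \<open>auto simp: mod_eq_def\<close>)
  then show ?thesis by (simp add: mod_eq_def free_act_diff)
qed

lemma free_act_lin_relators:
  assumes "s \<in> lin_relators sA"
  shows "mod_eq S (free_act C g x s) 0"
proof -
  have "mod_eq S (free_act C g x (gen (a + b))) (free_act C g x (gen a) + free_act C g x (gen b))" for a b
  proof -
    have "mod_eq S (free_act C g x (gen (a + b))) (gen (g x a + g x b))"
      using free_act_gen[of x "a + b"] by (simp add: add_right)
    also have "mod_eq S \<dots> (gen (g x a) + gen (g x b))" by (rule mod_eq_gen_add)
    also have "mod_eq S \<dots> (free_act C g x (gen a) + free_act C g x (gen b))"
      by (intro mod_eq_add mod_eq_sym[OF free_act_gen])
    finally show ?thesis .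
  qed
  moreover have "mod_eq S (free_act C g x (gen (sA c a))) (scalar c * free_act C g x (gen a))" for c a
  proof -
    have "mod_eq S (free_act C g x (gen (sA c a))) (gen (sB c (g x a)))"
      using free_act_gen[of x "sA c a"] by (simp add: scale_right)
    also have "mod_eq S \<dots> (scalar c * gen (g x a))" by (rule mod_eq_gen_scale)
    also have "mod_eq S \<dots> (scalar c * free_act C g x (gen a))"
      by (intro mod_eq_mult_left mod_eq_sym[OF free_act_gen])
    finally show ?thesis .
  qed
  ultimately show ?thesis
    using assms by (auto simp: lin_relators_def mod_eq_def free_act_diff free_act_add free_act_scalar diff_diff_eq)
qed

end

section \<open>Quotients of non-unital algebras\<close>

text \<open>
  The algebra \<open>B\<close> need not have a unit, so the quotient theory of rings does not apply to it; all
  computations are pulled back along a surjection \<open>\<pi>\<close> from a non-unital subalgebra \<open>P\<close> of a free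
  algebra.
\<close>

locale presentation =
  fixes B :: "('k::field, 'b) module" and P :: "('a list \<Rightarrow>\<^sub>0 'k) set" and \<pi>
  assumes P_0: "0 \<in> P"
    and P_add: "p \<in> P \<Longrightarrow> q \<in> P \<Longrightarrow> p + q \<in> P"
    and P_scalar: "p \<in> P \<Longrightarrow> scalar c * p \<in> P"
    and P_mult: "p \<in> P \<Longrightarrow> q \<in> P \<Longrightarrow> p * q \<in> P"
    and image: "\<pi> ` P = carrier B"
    and proj_0: "\<pi> 0 = \<zero>\<^bsub>B\<^esub>"
    and proj_add: "p \<in> P \<Longrightarrow> q \<in> P \<Longrightarrow> \<pi> (p + q) = \<pi> p \<oplus>\<^bsub>B\<^esub> \<pi> q"
    and proj_scalar: "p \<in> P \<Longrightarrow> \<pi> (scalar c * p) = c \<odot>\<^bsub>B\<^esub> \<pi> p"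
    and proj_mult: "p \<in> P \<Longrightarrow> q \<in> P \<Longrightarrow> \<pi> (p * q) = \<pi> p \<otimes>\<^bsub>B\<^esub> \<pi> q"
begin

lemma P_uminus: "p \<in> P \<Longrightarrow> - p \<in> P"
  using P_scalar[of p "- 1"] by simp

lemma P_diff: "p \<in> P \<Longrightarrow> q \<in> P \<Longrightarrow> p - q \<in> P"
  using P_add[of p "- q"] P_uminus[of q] by simp

lemmas P_closed = P_0 P_add P_scalar P_mult P_uminus P_diff

lemma proj_carrier: "p \<in> P \<Longrightarrow> \<pi> p \<in> carrier B"
  using image by blast

lemma ball_carrier_iff: "(\<forall>x\<in>carrier B. Q x) \<longleftrightarrow> (\<forall>p\<in>P. Q (\<pi> p))"
  by (simp flip: image)

lemma carrier_cases:
  assumes "x \<in> carrier B"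
  obtains p where "p \<in> P" "x = \<pi> p"
  using assms image by blast

lemma proj_add_sym: "p \<in> P \<Longrightarrow> q \<in> P \<Longrightarrow> \<pi> p \<oplus>\<^bsub>B\<^esub> \<pi> q = \<pi> (p + q)"
  and proj_scalar_sym: "p \<in> P \<Longrightarrow> c \<odot>\<^bsub>B\<^esub> \<pi> p = \<pi> (scalar c * p)"
  and proj_mult_sym: "p \<in> P \<Longrightarrow> q \<in> P \<Longrightarrow> \<pi> p \<otimes>\<^bsub>B\<^esub> \<pi> q = \<pi> (p * q)"
  and proj_0_sym: "\<zero>\<^bsub>B\<^esub> = \<pi> 0"
  by (simp_all add: proj_0 proj_add proj_scalar proj_mult)

lemmas proj_sym = proj_add_sym proj_scalar_sym proj_mult_sym proj_0_sym

lemma abelian_group: "abelian_group B"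
proof (rule abelian_groupI)
  fix x assume "x \<in> carrier B"
  then obtain p where "p \<in> P" "x = \<pi> p" by (rule carrier_cases)
  then show "\<exists>y\<in>carrier B. y \<oplus>\<^bsub>B\<^esub> x = \<zero>\<^bsub>B\<^esub>"
    by (intro bexI[of _ "\<pi> (- p)"]) (simp_all add: P_closed proj_carrier proj_sym)
qed (auto elim!: carrier_cases simp: proj_sym P_closed proj_carrier algebra_simps)

lemma proj_diff: "p \<in> P \<Longrightarrow> q \<in> P \<Longrightarrow> \<pi> (p - q) = \<pi> p \<ominus>\<^bsub>B\<^esub> \<pi> q"
proof -
  assume pq: "p \<in> P" "q \<in> P"
  have "\<ominus>\<^bsub>B\<^esub> \<pi> q = \<pi> (- q)"
    by (rule abelian_group.minus_equality[OF abelian_group])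
      (simp_all add: pq P_closed proj_carrier proj_sym)
  then show ?thesis by (simp add: a_minus_def pq P_closed proj_sym)
qed

lemma k_algebra:
  assumes "P = UNIV" "\<pi> 1 = \<one>\<^bsub>B\<^esub>"
  shows "k_algebra B"
proof -
  have one: "\<one>\<^bsub>B\<^esub> = \<pi> 1" using assms(2) by simp
  have "ring B"
    by (intro ringI abelian_group monoidI)
      (auto elim!: carrier_cases simp: proj_sym P_closed proj_carrier assms(1) one algebra_simps)
  moreover have "module (type_alg ((*) :: 'k \<Rightarrow> 'k \<Rightarrow> 'k)) B"
  proof (intro moduleI abelian_group)
    show "cring (type_alg ((*) :: 'k \<Rightarrow> 'k \<Rightarrow> 'k))"
      by (intro cringI abelian_groupI comm_monoidI)
        (auto simp: algebra_simps intro: exI[of _ "- x" for x])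
  qed (auto elim!: carrier_cases
      simp: proj_sym P_closed proj_carrier scalar_add scalar_mult distrib_left distrib_right mult.assoc)
  ultimately show ?thesis
    by (auto simp: k_algebra_def ball_carrier_iff proj_sym P_closed assms(1) mult.assoc
        mult_scalar_left_commute)
qed

context
  fixes S
  assumes S: "S \<subseteq> carrier B"
begin

lemma ideal_subset: "x \<in> ideal_gen B S \<Longrightarrow> x \<in> carrier B"
  by (induction rule: ideal_gen.induct)
    (use S in \<open>auto elim!: carrier_cases simp: proj_sym P_closed proj_carrier\<close>)

lemma proj_ideal_diff_add:
  assumes "p \<in> P" "q \<in> P" "p' \<in> P" "q' \<in> P"
    and "\<pi> (p - p') \<in> ideal_gen B S" "\<pi> (q - q') \<in> ideal_gen B S"
  shows "\<pi> ((p + q) - (p' + q')) \<in> ideal_gen B S"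
proof -
  have "\<pi> ((p + q) - (p' + q')) = \<pi> (p - p') \<oplus>\<^bsub>B\<^esub> \<pi> (q - q')"
    using assms by (simp add: proj_sym P_closed algebra_simps)
  with assms show ?thesis by (simp add: ideal_gen.intros)
qed

lemma proj_ideal_diff_mult:
  assumes "p \<in> P" "q \<in> P" "p' \<in> P" "q' \<in> P"
    and "\<pi> (p - p') \<in> ideal_gen B S" "\<pi> (q - q') \<in> ideal_gen B S"
  shows "\<pi> (p * q - p' * q') \<in> ideal_gen B S"
proof -
  have "\<pi> (p * q - p' * q') = \<pi> p \<otimes>\<^bsub>B\<^esub> \<pi> (q - q') \<oplus>\<^bsub>B\<^esub> \<pi> (p - p') \<otimes>\<^bsub>B\<^esub> \<pi> q'"
    using assms by (simp add: proj_sym P_closed algebra_simps)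
  with assms show ?thesis by (simp add: ideal_gen.intros proj_carrier)
qed

lemma proj_ideal_diff_scalar:
  assumes "p \<in> P" "p' \<in> P" "\<pi> (p - p') \<in> ideal_gen B S"
  shows "\<pi> (scalar c * p - scalar c * p') \<in> ideal_gen B S"
proof -
  have "\<pi> (scalar c * p - scalar c * p') = c \<odot>\<^bsub>B\<^esub> \<pi> (p - p')"
    using assms by (simp add: proj_sym P_closed algebra_simps)
  with assms show ?thesis by (simp add: ideal_gen.intros)
qed

lemma proj_ideal_diff_sym:
  assumes "p \<in> P" "q \<in> P" "\<pi> (p - q) \<in> ideal_gen B S"
  shows "\<pi> (q - p) \<in> ideal_gen B S"
  using ideal_gen.intros(4)[OF assms(3), of "- 1"] assms by (simp add: proj_sym P_closed)

lemma proj_ideal_diff_refl: "\<pi> (p - p) \<in> ideal_gen B S"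
  by (simp add: proj_0 ideal_gen.intros)

lemma proj_ideal_diff_trans:
  assumes "p \<in> P" "q \<in> P" "r \<in> P"
    and "\<pi> (p - q) \<in> ideal_gen B S" "\<pi> (q - r) \<in> ideal_gen B S"
  shows "\<pi> (p - r) \<in> ideal_gen B S"
  using ideal_gen.intros(3)[OF assms(4,5)] assms by (simp add: proj_sym P_closed)

lemma mem_coset_iff:
  assumes "p \<in> P"
  shows "x \<in> ideal_gen B S +>\<^bsub>B\<^esub> \<pi> p \<longleftrightarrow> (\<exists>q\<in>P. x = \<pi> q \<and> \<pi> (q - p) \<in> ideal_gen B S)"
proof
  assume "x \<in> ideal_gen B S +>\<^bsub>B\<^esub> \<pi> p"
  then obtain h where h: "h \<in> ideal_gen B S" "x = h \<oplus>\<^bsub>B\<^esub> \<pi> p"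
    by (auto simp: a_r_coset_def r_coset_def)
  then obtain m where "m \<in> P" "h = \<pi> m" by (meson ideal_subset carrier_cases)
  with h assms show "\<exists>q\<in>P. x = \<pi> q \<and> \<pi> (q - p) \<in> ideal_gen B S"
    by (intro bexI[of _ "m + p"]) (simp_all add: proj_sym P_closed)
next
  assume "\<exists>q\<in>P. x = \<pi> q \<and> \<pi> (q - p) \<in> ideal_gen B S"
  then obtain q where "q \<in> P" "x = \<pi> q" "\<pi> (q - p) \<in> ideal_gen B S" by blast
  moreover from this have "x = \<pi> (q - p) \<oplus>\<^bsub>B\<^esub> \<pi> p" using assms by (simp add: proj_sym P_closed)
  ultimately show "x \<in> ideal_gen B S +>\<^bsub>B\<^esub> \<pi> p"
    unfolding a_r_coset_def r_coset_def UN_iff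
    by (intro bexI[of _ "\<pi> (q - p)"]) simp_all
qed

lemma coset_eq_iff:
  assumes "p \<in> P" "q \<in> P"
  shows "ideal_gen B S +>\<^bsub>B\<^esub> \<pi> p = ideal_gen B S +>\<^bsub>B\<^esub> \<pi> q \<longleftrightarrow> \<pi> (p - q) \<in> ideal_gen B S"
proof
  assume "ideal_gen B S +>\<^bsub>B\<^esub> \<pi> p = ideal_gen B S +>\<^bsub>B\<^esub> \<pi> q"
  then have "\<pi> p \<in> ideal_gen B S +>\<^bsub>B\<^esub> \<pi> q"
    using mem_coset_iff[of p "\<pi> p"] assms proj_ideal_diff_refl by blast
  then obtain p' where p': "p' \<in> P" "\<pi> p = \<pi> p'" "\<pi> (p' - q) \<in> ideal_gen B S"
    using mem_coset_iff[of q] assms by blast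
  then show "\<pi> (p - q) \<in> ideal_gen B S" using assms by (simp add: proj_diff)
next
  assume "\<pi> (p - q) \<in> ideal_gen B S"
  then have "\<pi> (r - p) \<in> ideal_gen B S \<longleftrightarrow> \<pi> (r - q) \<in> ideal_gen B S" if "r \<in> P" for r
    using assms that proj_ideal_diff_trans proj_ideal_diff_sym by meson
  then show "ideal_gen B S +>\<^bsub>B\<^esub> \<pi> p = ideal_gen B S +>\<^bsub>B\<^esub> \<pi> q"
    using assms by (auto simp: mem_coset_iff)
qed

lemma quotient:
  "presentation (alg_quot B (ideal_gen B S)) P (\<lambda>p. ideal_gen B S +>\<^bsub>B\<^esub> \<pi> p)"
proof
  show "(\<lambda>p. ideal_gen B S +>\<^bsub>B\<^esub> \<pi> p) ` P = carrier (alg_quot B (ideal_gen B S))"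
  proof -
    have "carrier (alg_quot B (ideal_gen B S)) = (\<lambda>x. ideal_gen B S +>\<^bsub>B\<^esub> x) ` carrier B"
      by (auto simp: alg_quot_def ring.extend_def FactRing_def A_RCOSETS_def RCOSETS_def a_r_coset_def)
    then show ?thesis by (simp add: image_image flip: image)
  qed
  have "x \<in> ideal_gen B S +>\<^bsub>B\<^esub> \<pi> 0 \<longleftrightarrow> x \<in> ideal_gen B S" for x
    unfolding mem_coset_iff[OF P_0] diff_zero using ideal_subset[of x] carrier_cases[of x] by metis
  then show "ideal_gen B S +>\<^bsub>B\<^esub> \<pi> 0 = \<zero>\<^bsub>alg_quot B (ideal_gen B S)\<^esub>"
    by (auto simp: alg_quot_def ring.extend_def FactRing_def)
  fix p assume p: "p \<in> P"
  have "\<pi> p \<in> ideal_gen B S +>\<^bsub>B\<^esub> \<pi> p"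
    using p proj_ideal_diff_refl by (auto simp: mem_coset_iff)
  note p' = p this
  {
    fix c
    have "ideal_gen B S +>\<^bsub>B\<^esub> (c \<odot>\<^bsub>B\<^esub> x) = ideal_gen B S +>\<^bsub>B\<^esub> \<pi> (scalar c * p)"
      if x: "x \<in> ideal_gen B S +>\<^bsub>B\<^esub> \<pi> p" for x
    proof -
      from x p obtain q where q: "q \<in> P" "x = \<pi> q" "\<pi> (q - p) \<in> ideal_gen B S"
        by (auto simp: mem_coset_iff)
      with p show ?thesis
        by (simp add: proj_sym coset_eq_iff P_closed proj_ideal_diff_scalar)
    qed
    with p' show "ideal_gen B S +>\<^bsub>B\<^esub> \<pi> (scalar c * p)
        = c \<odot>\<^bsub>alg_quot B (ideal_gen B S)\<^esub> (ideal_gen B S +>\<^bsub>B\<^esub> \<pi> p)"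
      by (auto simp: alg_quot_def ring.extend_def module.fields_def)
  }
  fix q assume q: "q \<in> P"
  have "\<pi> q \<in> ideal_gen B S +>\<^bsub>B\<^esub> \<pi> q"
    using q proj_ideal_diff_refl by (auto simp: mem_coset_iff)
  note q' = q this
  have "ideal_gen B S +>\<^bsub>B\<^esub> (x \<otimes>\<^bsub>B\<^esub> y) = ideal_gen B S +>\<^bsub>B\<^esub> \<pi> (p * q)"
    if x: "x \<in> ideal_gen B S +>\<^bsub>B\<^esub> \<pi> p" "y \<in> ideal_gen B S +>\<^bsub>B\<^esub> \<pi> q" for x y
  proof -
    from x p q obtain s t where "s \<in> P" "x = \<pi> s" "\<pi> (s - p) \<in> ideal_gen B S"
      "t \<in> P" "y = \<pi> t" "\<pi> (t - q) \<in> ideal_gen B S"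
      by (auto simp: mem_coset_iff)
    with p q show ?thesis
      by (simp add: proj_sym coset_eq_iff P_closed proj_ideal_diff_mult)
  qed
  with p' q' show "ideal_gen B S +>\<^bsub>B\<^esub> \<pi> (p * q)
      = (ideal_gen B S +>\<^bsub>B\<^esub> \<pi> p) \<otimes>\<^bsub>alg_quot B (ideal_gen B S)\<^esub> (ideal_gen B S +>\<^bsub>B\<^esub> \<pi> q)"
    by (auto simp: alg_quot_def ring.extend_def FactRing_def rcoset_mult_def)
  have "x \<in> ideal_gen B S +>\<^bsub>B\<^esub> \<pi> (p + q) \<longleftrightarrow>
      x \<in> (ideal_gen B S +>\<^bsub>B\<^esub> \<pi> p) <+>\<^bsub>B\<^esub> (ideal_gen B S +>\<^bsub>B\<^esub> \<pi> q)" (is "?l \<longleftrightarrow> ?r") for x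
  proof
    assume ?l
    then obtain s where s: "s \<in> P" "x = \<pi> s" "\<pi> (s - (p + q)) \<in> ideal_gen B S"
      using p q by (auto simp: mem_coset_iff P_closed)
    have "\<pi> (s - q) \<in> ideal_gen B S +>\<^bsub>B\<^esub> \<pi> p"
      using s p q by (auto simp: mem_coset_iff P_closed algebra_simps intro!: bexI[of _ "s - q"])
    moreover have "x = \<pi> (s - q) \<oplus>\<^bsub>B\<^esub> \<pi> q"
      using s q by (simp add: proj_sym P_closed)
    ultimately show ?r using q' by (auto simp: set_add_def set_mult_def)
  next
    assume ?r
    then obtain s t where "s \<in> P" "t \<in> P" "x = \<pi> s \<oplus>\<^bsub>B\<^esub> \<pi> t"
      "\<pi> (s - p) \<in> ideal_gen B S" "\<pi> (t - q) \<in> ideal_gen B S"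
      using p q by (auto simp: set_add_def set_mult_def mem_coset_iff)
    with p q show ?l
      using proj_ideal_diff_add[of s t p q]
      by (auto simp: mem_coset_iff P_closed proj_sym intro!: bexI[of _ "s + t"])
  qed
  then show "ideal_gen B S +>\<^bsub>B\<^esub> \<pi> (p + q)
      = (ideal_gen B S +>\<^bsub>B\<^esub> \<pi> p) \<oplus>\<^bsub>alg_quot B (ideal_gen B S)\<^esub> (ideal_gen B S +>\<^bsub>B\<^esub> \<pi> q)"
    by (auto simp: alg_quot_def ring.extend_def FactRing_def)
qed (simp_all add: P_closed)

end

end

section \<open>The enveloping algebra as a quotient of a free algebra\<close>

definition lie_relators ::
  "('k::field_char_0, 'r::{comm_ring, comm_monoid_mult}, 'l::ab_group_add) lie_rinehart_data
    \<Rightarrow> (('r \<times> 'l) list \<Rightarrow>\<^sub>0 'k) set" where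
  "lie_relators A = lin_relators (sd_scale A)
    \<union> {gen a * gen b - gen b * gen a - gen (sd_bracket A a b) | a b. True}"

definition ract_relators ::
  "('k::field_char_0, 'r::{comm_ring, comm_monoid_mult}, 'l::ab_group_add) lie_rinehart_data
    \<Rightarrow> (('r \<times> 'l) list \<Rightarrow>\<^sub>0 'k) set" where
  "ract_relators A = {gen (r\<^sub>1 * r\<^sub>2, ract A r\<^sub>1 Z\<^sub>2) - gen (r\<^sub>1, 0) * gen (r\<^sub>2, Z\<^sub>2) | r\<^sub>1 r\<^sub>2 Z\<^sub>2. True}"

text \<open>
  The relator \<open>gen (1, 0) - 1\<close> identifies the unit of the free algebra with that of \<^const>\<open>lr_V\<close>,
  so that the non-unital subalgebra is not needed in this description.
\<close>

definition lr_relators ::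
  "('k::field_char_0, 'r::{comm_ring, comm_monoid_mult}, 'l::ab_group_add) lie_rinehart_data
    \<Rightarrow> (('r \<times> 'l) list \<Rightarrow>\<^sub>0 'k) set" where
  "lr_relators A = lie_relators A \<union> ract_relators A \<union> {gen (1, 0) - 1}"

abbreviation augmentation_ideal :: "('a list \<Rightarrow>\<^sub>0 'k::field) set" where
  "augmentation_ideal \<equiv> subalgebra_gen free_algebra (range gen)"

lemmas augmentation_ideal_intros = subalgebra_gen.intros[where B = free_algebra, simplified]

lemma gen_augmentation_ideal: "gen a \<in> augmentation_ideal"
  by (simp add: augmentation_ideal_intros)

lemma augmentation_ideal_mult_right: "p \<in> augmentation_ideal \<Longrightarrow> p * q \<in> augmentation_ideal"
proof (induction q arbitrary: p rule: free_algebra_induct)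
  case (scalar_word c w)
  have "p * word w \<in> augmentation_ideal"
    using scalar_word
    by (induction w arbitrary: p) (auto simp: word_Cons augmentation_ideal_intros simp flip: mult.assoc)
  then show ?case by (simp add: mult_scalar_left_commute augmentation_ideal_intros)
qed (simp add: distrib_left augmentation_ideal_intros)

lemma augmentation_ideal_mult_left: "p \<in> augmentation_ideal \<Longrightarrow> q * p \<in> augmentation_ideal"
proof (induction q arbitrary: p rule: free_algebra_induct)
  case (scalar_word c w)
  have "word w * p \<in> augmentation_ideal"
    using scalar_word
    by (induction w arbitrary: p) (auto simp: word_Cons augmentation_ideal_intros mult.assoc)
  then show ?case by (simp add: mult.assoc augmentation_ideal_intros)
qed (simp add: distrib_right augmentation_ideal_intros)

context lie_rinehart
begin

lemma linear_0 [simp]: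
  "lscale A c 0 = 0" "anchor A 0 r = 0" "lbracket A Z 0 = 0"
proof -
  show "lscale A c 0 = 0"
    using lscale_vector_space unfolding vector_space_def by (metis add_cancel_right_right)
  show "anchor A 0 r = 0" "lbracket A Z 0 = 0"
    using anchor_linear_left[of r] lbracket_linear_right[of Z]
    unfolding Vector_Spaces.linear_def by (auto dest: module_hom.zero)
qed

lemma anchor_1: "anchor A Z 1 = 0"
  using anchor_derivation[of Z 1 1] by simp

definition U_proj :: "(('r \<times> 'l) list \<Rightarrow>\<^sub>0 'k) \<Rightarrow> (('r \<times> 'l) list \<Rightarrow>\<^sub>0 'k) set" where
  "U_proj p = ideal_gen free_algebra (lie_relators A) +>\<^bsub>free_algebra\<^esub> p"

sublocale free: presentation "free_algebra :: ('k, ('r \<times> 'l) list \<Rightarrow>\<^sub>0 'k) module" UNIV "\<lambda>p. p"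
  by unfold_locales simp_all

sublocale U: presentation "lr_U A" UNIV U_proj
  using free.quotient[of "lie_relators A"]
  by (simp add: lr_U_def lie_enveloping_def lie_relators_def U_proj_def[abs_def])

lemma U_proj_eq_iff: "U_proj p = U_proj q \<longleftrightarrow> mod_eq (lie_relators A) p q"
  using free.coset_eq_iff[of "lie_relators A" p q] by (simp add: U_proj_def mod_eq_def)

lemma lr_U_map_eq: "lr_U_map A a = U_proj (gen a)"
  by (simp add: lr_U_map_def lie_enveloping_map_def lie_relators_def U_proj_def)

lemma U_proj_augmentation_ideal:
  "U_proj ` augmentation_ideal = subalgebra_gen (lr_U A) (range (lr_U_map A))"
proof (intro equalityI subsetI)
  fix x assume "x \<in> U_proj ` augmentation_ideal"
  then obtain p where p: "p \<in> augmentation_ideal" "x = U_proj p" by blast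
  from p(1) show "x \<in> subalgebra_gen (lr_U A) (range (lr_U_map A))"
    unfolding p(2)
  proof induction
    case (4 p c)
    then show ?case by (simp add: U.proj_scalar subalgebra_gen.intros)
  qed (auto simp: U.proj_0 U.proj_add U.proj_mult lr_U_map_eq intro: subalgebra_gen.intros)
next
  fix x assume "x \<in> subalgebra_gen (lr_U A) (range (lr_U_map A))"
  then show "x \<in> U_proj ` augmentation_ideal"
    by induction (auto simp: U.proj_sym lr_U_map_eq augmentation_ideal_intros)
qed

sublocale Ubar: presentation "lr_Ubar A" augmentation_ideal U_proj
proof
  show "U_proj (scalar c * p) = c \<odot>\<^bsub>lr_Ubar A\<^esub> U_proj p" for c p
    by (simp add: lr_Ubar_def U.proj_scalar)
qed (simp_all add: lr_Ubar_def U_proj_augmentation_ideal U.proj_0 U.proj_add U.proj_mult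
    augmentation_ideal_intros)

lemma lr_ideal_eq: "lr_ideal A = ideal_gen (lr_Ubar A) (U_proj ` ract_relators A)"
proof -
  have "{lr_U_map A (r\<^sub>1 * r\<^sub>2, ract A r\<^sub>1 Z\<^sub>2) \<ominus>\<^bsub>lr_U A\<^esub> (lr_U_map A (r\<^sub>1, 0) \<otimes>\<^bsub>lr_U A\<^esub> lr_U_map A (r\<^sub>2, Z\<^sub>2))
      | r\<^sub>1 r\<^sub>2 Z\<^sub>2. True} = U_proj ` ract_relators A"
    by (auto simp: ract_relators_def lr_U_map_eq U.proj_mult_sym simp flip: U.proj_diff)
  then show ?thesis by (simp add: lr_ideal_def)
qed

lemma ract_relators_subset: "ract_relators A \<subseteq> augmentation_ideal"
  by (auto simp: ract_relators_def Ubar.P_closed gen_augmentation_ideal)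

lemma U_proj_ract_relators_subset: "U_proj ` ract_relators A \<subseteq> carrier (lr_Ubar A)"
  using ract_relators_subset by (auto intro: Ubar.proj_carrier)

definition V_proj' :: "(('r \<times> 'l) list \<Rightarrow>\<^sub>0 'k) \<Rightarrow> (('r \<times> 'l) list \<Rightarrow>\<^sub>0 'k) set set" where
  "V_proj' p = lr_ideal A +>\<^bsub>lr_Ubar A\<^esub> U_proj p"

lemma presentation_V':
  "presentation (alg_quot (lr_Ubar A) (lr_ideal A)) augmentation_ideal V_proj'"
  using Ubar.quotient[OF U_proj_ract_relators_subset]
  by (simp add: V_proj'_def[abs_def] lr_ideal_eq)

sublocale V': presentation "lr_V A" augmentation_ideal V_proj'
  using presentation_V' by (simp add: presentation_def lr_V_def)

lemma V_proj'_eq_iff: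
  assumes "p \<in> augmentation_ideal" "q \<in> augmentation_ideal"
  shows "V_proj' p = V_proj' q \<longleftrightarrow> U_proj (p - q) \<in> lr_ideal A"
  using Ubar.coset_eq_iff[OF U_proj_ract_relators_subset assms] by (simp add: V_proj'_def lr_ideal_eq)

lemma V_proj'_eq_if_lie:
  assumes "p \<in> augmentation_ideal" "q \<in> augmentation_ideal" "mod_eq (lie_relators A) p q"
  shows "V_proj' p = V_proj' q"
  using assms U_proj_eq_iff[of p q] by (simp add: V_proj'_def)

lemma V_proj'_ract:
  "V_proj' (gen (r\<^sub>1 * r\<^sub>2, ract A r\<^sub>1 Z\<^sub>2)) = V_proj' (gen (r\<^sub>1, 0) * gen (r\<^sub>2, Z\<^sub>2))"
  by (subst V_proj'_eq_iff)
    (auto simp: lr_ideal_eq ract_relators_def Ubar.P_closed gen_augmentation_ideal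
      intro!: ideal_gen.intros(1))

abbreviation unit :: "('r \<times> 'l) list \<Rightarrow>\<^sub>0 'k" where
  "unit \<equiv> gen (1, 0)"

lemma V_proj'_unit_left:
  assumes "p \<in> augmentation_ideal"
  shows "V_proj' (unit * p) = V_proj' p"
  using assms
proof induction
  case (1 s)
  then obtain r Z where "s = gen (r, Z)" by auto
  then show ?case using V_proj'_ract[of 1 r Z] by (simp add: ract_one)
next
  case (4 p c)
  then show ?case
    by (simp add: mult_scalar_left_commute V'.proj_scalar V'.P_mult gen_augmentation_ideal)
next
  case (5 p q)
  then show ?case
    by (simp add: V'.proj_mult V'.P_mult gen_augmentation_ideal flip: mult.assoc)
qed (simp_all add: distrib_left V'.proj_add V'.P_mult gen_augmentation_ideal)

lemma V_proj'_unit_right: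
  assumes "p \<in> augmentation_ideal"
  shows "V_proj' (p * unit) = V_proj' p"
  using assms
proof induction
  case (1 s)
  then obtain r Z where s: "s = gen (r, Z)" by auto
  have zero: "mod_eq (lie_relators A) (gen 0) 0"
  proof -
    have "gen (0 + 0) - gen 0 - gen 0 \<in> lin_relators (sd_scale A)"
      unfolding lin_relators_def by blast
    then have "mod_eq (lie_relators A) (- gen 0) 0"
      by (intro mod_eq_base) (simp add: lie_relators_def)
    from mod_eq_uminus[OF this] show ?thesis by simp
  qed
  have "mod_eq (lie_relators A) (s * unit - unit * s) (gen (sd_bracket A (r, Z) (1, 0)))"
    by (rule mod_eq_base) (auto simp: lie_relators_def s)
  also have "sd_bracket A (r, Z) (1, 0) = 0"
    by (simp add: sd_bracket_def anchor_1 zero_prod_def)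
  also note zero
  finally have "mod_eq (lie_relators A) (s * unit) (unit * s)"
    by (simp add: mod_eq_def)
  then have "V_proj' (s * unit) = V_proj' (unit * s)"
    by (intro V_proj'_eq_if_lie) (auto simp: s intro: augmentation_ideal_intros)
  with V_proj'_unit_left show ?case by (simp add: s augmentation_ideal_intros)
next
  case (4 p c)
  then show ?case
    by (simp add: mult.assoc V'.proj_scalar V'.P_mult gen_augmentation_ideal)
next
  case (5 p q)
  then show ?case
    by (simp add: mult.assoc V'.proj_mult V'.P_mult gen_augmentation_ideal)
qed (simp_all add: distrib_right V'.proj_add V'.P_mult gen_augmentation_ideal)

lemma lr_ideal_imp_mod_eq:
  assumes "x \<in> lr_ideal A" "U_proj p = x"
  shows "mod_eq (lr_relators A) p 0"
  using assms unfolding lr_ideal_eq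
proof (induction arbitrary: p)
  have mono: "lie_relators A \<subseteq> lr_relators A" by (auto simp: lr_relators_def)
  have lift: "mod_eq (lr_relators A) q 0"
    if "U_proj q = U_proj p" "mod_eq (lr_relators A) p 0" for p q
    using that mod_eq_mono[OF mono, of q p] by (auto simp: U_proj_eq_iff intro: mod_eq_trans)
  have carrier: "x \<in> carrier (lr_Ubar A)"
    if "x \<in> ideal_gen (lr_Ubar A) (U_proj ` ract_relators A)" for x
    using Ubar.ideal_subset[OF U_proj_ract_relators_subset that] .
  {
    case (1 x)
    then obtain s where "s \<in> ract_relators A" "x = U_proj s" by blast
    moreover from this have "mod_eq (lr_relators A) s 0"
      by (intro mod_eq_base) (simp add: lr_relators_def)
    ultimately show ?case using 1 by (intro lift[of p s]) simp_all
  next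
    case 2
    then show ?case by (intro lift[of p 0]) (simp_all add: Ubar.proj_0)
  next
    case (3 x y)
    obtain p\<^sub>1 where p\<^sub>1: "p\<^sub>1 \<in> augmentation_ideal" "x = U_proj p\<^sub>1"
      by (rule Ubar.carrier_cases[OF carrier[OF 3(1)]])
    obtain p\<^sub>2 where p\<^sub>2: "p\<^sub>2 \<in> augmentation_ideal" "y = U_proj p\<^sub>2"
      by (rule Ubar.carrier_cases[OF carrier[OF 3(2)]])
    have "mod_eq (lr_relators A) (p\<^sub>1 + p\<^sub>2) 0"
      using mod_eq_add[OF 3(3)[OF p\<^sub>1(2)[symmetric]] 3(4)[OF p\<^sub>2(2)[symmetric]]] by simp
    then show ?case
      by (rule lift[rotated]) (simp add: 3(5) p\<^sub>1 p\<^sub>2 Ubar.proj_add)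
  next
    case (4 x c)
    obtain q where q: "q \<in> augmentation_ideal" "x = U_proj q"
      by (rule Ubar.carrier_cases[OF carrier[OF 4(1)]])
    have "mod_eq (lr_relators A) (scalar c * q) 0"
      using mod_eq_mult_left[OF 4(2)[OF q(2)[symmetric]]] by fastforce
    then show ?case
      by (rule lift[rotated]) (simp only: 4(3) q Ubar.proj_scalar)
  next
    case (5 x b)
    obtain q where q: "q \<in> augmentation_ideal" "x = U_proj q"
      by (rule Ubar.carrier_cases[OF carrier[OF 5(1)]])
    obtain b' where b': "b' \<in> augmentation_ideal" "b = U_proj b'"
      by (rule Ubar.carrier_cases[OF 5(2)])
    have "mod_eq (lr_relators A) (b' * q) 0"
      using mod_eq_mult_left[OF 5(3)[OF q(2)[symmetric]]] by fastforce
    then show ?case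
      by (rule lift[rotated]) (simp only: 5(4) q b' Ubar.proj_mult)
  next
    case (6 x b)
    obtain q where q: "q \<in> augmentation_ideal" "x = U_proj q"
      by (rule Ubar.carrier_cases[OF carrier[OF 6(1)]])
    obtain b' where b': "b' \<in> augmentation_ideal" "b = U_proj b'"
      by (rule Ubar.carrier_cases[OF 6(2)])
    have "mod_eq (lr_relators A) (q * b') 0"
      using mod_eq_mult_right[OF 6(3)[OF q(2)[symmetric]]] by fastforce
    then show ?case
      by (rule lift[rotated]) (simp only: 6(4) q b' Ubar.proj_mult)
  }
qed

lemma unit_mult_closed: "unit * p \<in> augmentation_ideal" "p * unit \<in> augmentation_ideal"
  by (auto intro: augmentation_ideal_mult_left augmentation_ideal_mult_right augmentation_ideal_intros)

lemma V_proj'_relator: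
  assumes "s \<in> lr_relators A" "b \<in> augmentation_ideal" "b' \<in> augmentation_ideal"
  shows "V_proj' (b * s * b') = V_proj' 0"
proof -
  have bs: "b * q \<in> augmentation_ideal" "q * b' \<in> augmentation_ideal" for q
    using assms(2,3) by (simp_all add: augmentation_ideal_mult_left augmentation_ideal_mult_right)
  consider "s \<in> lie_relators A" | "s \<in> ract_relators A" | "s = unit - 1"
    using assms(1) by (auto simp: lr_relators_def)
  then show ?thesis
  proof cases
    case 1
    then have "mod_eq (lie_relators A) (b * s * b') 0"
      using mod_eq_mult_right[OF mod_eq_mult_left[OF mod_eq_base[of s 0]], of "lie_relators A" b b']
      by simp
    then show ?thesis by (intro V_proj'_eq_if_lie bs augmentation_ideal_intros)
  next
    case 2
    then have "V_proj' s = V_proj' 0"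
      using ract_relators_subset
      by (subst V_proj'_eq_iff) (auto simp: lr_ideal_eq V'.P_0 intro!: ideal_gen.intros(1))
    moreover have "s \<in> augmentation_ideal" using 2 ract_relators_subset by blast
    ultimately have "V_proj' (b * s * b') = V_proj' (b * 0 * b')"
      using assms(2,3) by (simp add: V'.proj_mult augmentation_ideal_intros del: mult_zero_left mult_zero_right)
    then show ?thesis by simp
  next
    case 3
    have "V_proj' (b * s) = V_proj' (b * unit - b)"
      by (simp add: 3 right_diff_distrib)
    also have "\<dots> = V_proj' (b - b)"
      unfolding V'.proj_diff[OF bs(1) assms(2)] V'.proj_diff[OF assms(2) assms(2)]
      by (simp add: V_proj'_unit_right assms(2))
    finally have "V_proj' (b * s * b') = V_proj' (0 * b')"
      unfolding V'.proj_mult[OF bs(1) assms(3)] V'.proj_mult[OF V'.P_0 assms(3)] by simp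
    then show ?thesis by simp
  qed
qed

lemma V_proj'_ideal:
  assumes "p \<in> ideal_gen free_algebra (lr_relators A)" "b \<in> augmentation_ideal" "b' \<in> augmentation_ideal"
  shows "V_proj' (b * p * b') = V_proj' 0"
  using assms
proof (induction arbitrary: b b')
  case (3 p q)
  then have "V_proj' (b * p * b' + b * q * b') = V_proj' (0 + 0)"
    unfolding V'.proj_add[OF V'.P_0 V'.P_0]
    by (simp add: V'.proj_add augmentation_ideal_mult_right)
  then show ?case by (simp add: algebra_simps)
next
  case (4 p c)
  have "V_proj' (b * (scalar c * p) * b') = V_proj' (scalar c * (b * p * b'))"
    by (simp add: mult_scalar_left_commute mult.assoc)
  also have "\<dots> = V_proj' (scalar c * 0)"
    using 4 by (simp add: V'.proj_scalar augmentation_ideal_mult_right augmentation_ideal_intros del: mult_zero_right)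
  finally show ?case by simp
next
  case (5 p d)
  then show ?case using 5(3)[of "b * d" b'] by (simp add: mult.assoc augmentation_ideal_mult_right)
next
  case (6 p d)
  then show ?case using 6(3)[of b "d * b'"] by (simp add: mult.assoc augmentation_ideal_mult_left)
qed (simp_all add: V_proj'_relator)

text \<open>Multiplication by \<open>(1, 0)\<close> extends \<open>V_proj'\<close> from the augmentation ideal to the free algebra.\<close>

definition V_proj :: "(('r \<times> 'l) list \<Rightarrow>\<^sub>0 'k) \<Rightarrow> (('r \<times> 'l) list \<Rightarrow>\<^sub>0 'k) set set" where
  "V_proj p = V_proj' (unit * p)"

lemma V_proj_augmentation_ideal: "p \<in> augmentation_ideal \<Longrightarrow> V_proj p = V_proj' p"
  by (simp add: V_proj_def V_proj'_unit_left)

lemma V_proj_gen: "V_proj (gen a) = lr_V_map A a"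
  by (simp add: V_proj_augmentation_ideal augmentation_ideal_intros V_proj'_def lr_V_map_def lr_U_map_eq)

lemma V_proj_1: "V_proj 1 = \<one>\<^bsub>lr_V A\<^esub>"
  using V_proj_gen[of "(1, 0)"] V_proj'_unit_left[of unit]
  by (simp add: V_proj_def lr_V_def augmentation_ideal_intros)

sublocale V: presentation "lr_V A" UNIV V_proj
proof
  show "range V_proj = carrier (lr_V A)"
  proof (intro equalityI subsetI)
    fix x assume "x \<in> carrier (lr_V A)"
    then obtain p where "p \<in> augmentation_ideal" "x = V_proj' p" by (rule V'.carrier_cases)
    then show "x \<in> range V_proj" by (simp flip: V_proj_augmentation_ideal)
  qed (auto simp: V_proj_def V'.proj_carrier unit_mult_closed)
  fix p q
  have "V_proj (p * q) = V_proj' (unit * p * q)" by (simp add: V_proj_def mult.assoc)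
  also have "\<dots> = V_proj' (unit * p * q * unit)"
    by (simp add: V_proj'_unit_right augmentation_ideal_mult_right unit_mult_closed)
  also have "\<dots> = V_proj' (unit * p) \<otimes>\<^bsub>lr_V A\<^esub> V_proj' (q * unit)"
    using unit_mult_closed by (simp add: mult.assoc flip: V'.proj_mult)
  also have "V_proj' (q * unit) = V_proj' (unit * (q * unit))"
    by (simp add: V_proj'_unit_left unit_mult_closed)
  also have "\<dots> = V_proj' (unit * q)"
    by (simp add: V_proj'_unit_right unit_mult_closed flip: mult.assoc)
  finally show "V_proj (p * q) = V_proj p \<otimes>\<^bsub>lr_V A\<^esub> V_proj q" by (simp add: V_proj_def)
qed (auto simp: V_proj_def distrib_left mult_scalar_left_commute V'.proj_0 V'.proj_add V'.proj_scalar
    unit_mult_closed)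

lemma k_algebra_lr_V: "k_algebra (lr_V A)"
  by (rule V.k_algebra) (simp_all add: V_proj_1)

lemma V_proj_eq_iff: "V_proj p = V_proj q \<longleftrightarrow> mod_eq (lr_relators A) p q"
proof
  assume "V_proj p = V_proj q"
  then have "U_proj (unit * p - unit * q) \<in> lr_ideal A"
    using V_proj'_eq_iff unit_mult_closed by (auto simp: V_proj_def)
  then have *: "mod_eq (lr_relators A) (unit * p) (unit * q)"
    using lr_ideal_imp_mod_eq[OF _ refl] by (simp add: mod_eq_def)
  have unit: "mod_eq (lr_relators A) (unit * q) q" for q
    using mod_eq_mult_right[OF mod_eq_base[of unit 1 "lr_relators A"], of q]
    by (simp add: lr_relators_def)
  show "mod_eq (lr_relators A) p q"
    by (rule mod_eq_trans[OF mod_eq_trans[OF mod_eq_sym[OF unit] *] unit])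
next
  assume "mod_eq (lr_relators A) p q"
  then have "V_proj' (unit * (p - q) * unit) = V_proj' 0"
    by (intro V_proj'_ideal) (auto simp: mod_eq_def intro: augmentation_ideal_intros)
  then have "V_proj' (unit * p - unit * q) = V_proj' 0"
    using V_proj'_unit_right[OF unit_mult_closed(1), of "p - q"] by (simp add: right_diff_distrib)
  then show "V_proj p = V_proj q"
    using unit_mult_closed
    by (simp add: V_proj_def V'.P_diff V'.P_0 V_proj'_eq_iff)
qed

end

section \<open>Measurings of Lie-Rinehart algebras\<close>

lemma sum_list_Pair:
  "(\<Sum>(y, z)\<leftarrow>l. (f y z, h y z)) = ((\<Sum>(y, z)\<leftarrow>l. f y z), (\<Sum>(y, z)\<leftarrow>l. h y z))"
  by (induction l) (auto simp: zero_prod_def)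

lemma sum_list_diff:
  fixes f :: "'x \<Rightarrow> 'y \<Rightarrow> 'z::ab_group_add"
  shows "(\<Sum>(y, z)\<leftarrow>l. f y z) - (\<Sum>(y, z)\<leftarrow>l. h y z) = (\<Sum>(y, z)\<leftarrow>l. f y z - h y z)"
  by (induction l) auto

locale measured_lie_rinehart =
  cocommutative_coalgebra C + A: lie_rinehart A + A': lie_rinehart A'
  for C :: "('k::field_char_0, 'c::ab_group_add) coalgebra_data"
    and A :: "('k, 'r::{comm_ring, comm_monoid_mult}, 'l::ab_group_add) lie_rinehart_data"
    and A' :: "('k, 's::{comm_ring, comm_monoid_mult}, 'm::ab_group_add) lie_rinehart_data" +
  fixes \<Psi> :: "'c \<Rightarrow> 'l \<Rightarrow> 'm" and \<psi> :: "'c \<Rightarrow> 'r \<Rightarrow> 's"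
  assumes measuring: "lr_measuring C A A' \<Psi> \<psi>"
begin

lemma
  shows \<psi>_add_right: "\<psi> x (r + r') = \<psi> x r + \<psi> x r'"
    and \<psi>_scale_right: "\<psi> x (rscale A c r) = rscale A' c (\<psi> x r)"
    and \<psi>_add_left: "\<psi> (x + y) r = \<psi> x r + \<psi> y r"
    and \<psi>_scale_left: "\<psi> (cscale C c x) r = rscale A' c (\<psi> x r)"
    and \<psi>_1: "\<psi> x 1 = rscale A' (counit C x) 1"
    and \<psi>_mult: "\<psi> x (r * r') = (\<Sum>(y, z)\<leftarrow>comult C x. \<psi> y r * \<psi> z r')"
  using measuring by (simp_all add: lr_measuring_def alg_measuring_def type_alg_def sum_list.eq_foldr)

lemma
  shows \<Psi>_add_right: "\<Psi> x (Z + Z') = \<Psi> x Z + \<Psi> x Z'"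
    and \<Psi>_scale_right: "\<Psi> x (lscale A c Z) = lscale A' c (\<Psi> x Z)"
    and \<Psi>_add_left: "\<Psi> (x + y) Z = \<Psi> x Z + \<Psi> y Z"
    and \<Psi>_scale_left: "\<Psi> (cscale C c x) Z = lscale A' c (\<Psi> x Z)"
  using measuring
  unfolding lr_measuring_def Vector_Spaces.linear_def module_hom_def module_hom_axioms_def by auto

lemma \<Psi>_lbracket: "\<Psi> x (lbracket A Z\<^sub>1 Z\<^sub>2) = (\<Sum>(y, z)\<leftarrow>comult C x. lbracket A' (\<Psi> y Z\<^sub>1) (\<Psi> z Z\<^sub>2))"
  and \<psi>_anchor: "\<psi> x (anchor A Z r) = (\<Sum>(y, z)\<leftarrow>comult C x. anchor A' (\<Psi> y Z) (\<psi> z r))"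
  and \<Psi>_ract: "\<Psi> x (ract A r Z) = (\<Sum>(y, z)\<leftarrow>comult C x. ract A' (\<psi> y r) (\<Psi> z Z))"
  using measuring unfolding lr_measuring_def by blast+

lemma \<Psi>_0: "\<Psi> x 0 = 0"
  using \<Psi>_add_right[of x 0 0] by simp

lemma \<psi>_diff: "\<psi> x (r - r') = \<psi> x r - \<psi> x r'"
  using \<psi>_add_right[of x "r - r'" r'] by simp

definition pair_act :: "'c \<Rightarrow> 'r \<times> 'l \<Rightarrow> 's \<times> 'm" where
  "pair_act x = (\<lambda>(r, Z). (\<psi> x r, \<Psi> x Z))"

sublocale act: bilinear_action C "sd_scale A" "sd_scale A'" pair_act "lr_relators A'"
  by unfold_locales
    (auto simp: lr_relators_def lie_relators_def pair_act_def sd_scale_def \<psi>_add_right \<psi>_scale_right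
      \<psi>_add_left \<psi>_scale_left \<Psi>_add_right \<Psi>_scale_right \<Psi>_add_left \<Psi>_scale_left)

abbreviation lr_eq :: "(('s \<times> 'm) list \<Rightarrow>\<^sub>0 'k) \<Rightarrow> (('s \<times> 'm) list \<Rightarrow>\<^sub>0 'k) \<Rightarrow> bool" (infix "\<approx>" 50) where
  "p \<approx> q \<equiv> mod_eq (lr_relators A') p q"

abbreviation free_act' :: "'c \<Rightarrow> (('r \<times> 'l) list \<Rightarrow>\<^sub>0 'k) \<Rightarrow> ('s \<times> 'm) list \<Rightarrow>\<^sub>0 'k" where
  "free_act' \<equiv> free_act C pair_act"

lemma free_act_unit: "free_act' x (gen (1, 0)) \<approx> free_act' x 1"
proof -
  have "free_act' x (gen (1, 0)) \<approx> gen (pair_act x (1, 0))"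
    by (rule act.free_act_gen)
  also have "pair_act x (1, 0) = sd_scale A' (counit C x) (1, 0)"
    by (simp add: pair_act_def sd_scale_def \<psi>_1 \<Psi>_0)
  also have "gen \<dots> \<approx> scalar (counit C x) * gen (1, 0)"
    by (rule act.mod_eq_gen_scale)
  also have "\<dots> \<approx> scalar (counit C x) * 1"
    by (intro mod_eq_mult_left mod_eq_base) (simp add: lr_relators_def)
  finally show ?thesis by (simp add: act.free_act_1)
qed

lemma free_act_ract:
  "free_act' x (gen (r\<^sub>1 * r\<^sub>2, ract A r\<^sub>1 Z\<^sub>2)) \<approx> free_act' x (gen (r\<^sub>1, 0) * gen (r\<^sub>2, Z\<^sub>2))"
proof -
  have "free_act' x (gen (r\<^sub>1 * r\<^sub>2, ract A r\<^sub>1 Z\<^sub>2)) \<approx> gen (pair_act x (r\<^sub>1 * r\<^sub>2, ract A r\<^sub>1 Z\<^sub>2))"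
    by (rule act.free_act_gen)
  also have "pair_act x (r\<^sub>1 * r\<^sub>2, ract A r\<^sub>1 Z\<^sub>2)
      = (\<Sum>(y, z)\<leftarrow>comult C x. (\<psi> y r\<^sub>1 * \<psi> z r\<^sub>2, ract A' (\<psi> y r\<^sub>1) (\<Psi> z Z\<^sub>2)))"
    by (simp add: pair_act_def \<psi>_mult \<Psi>_ract sum_list_Pair)
  also have "gen \<dots> \<approx> (\<Sum>(y, z)\<leftarrow>comult C x. gen (\<psi> y r\<^sub>1 * \<psi> z r\<^sub>2, ract A' (\<psi> y r\<^sub>1) (\<Psi> z Z\<^sub>2)))"
    by (rule act.mod_eq_gen_sum_list)
  also have "\<dots> \<approx> (\<Sum>(y, z)\<leftarrow>comult C x. gen (pair_act y (r\<^sub>1, 0)) * gen (pair_act z (r\<^sub>2, Z\<^sub>2)))"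
    by (intro mod_eq_sum_list mod_eq_base)
      (auto simp: lr_relators_def ract_relators_def pair_act_def \<Psi>_0)
  also have "\<dots> \<approx> free_act' x (gen (r\<^sub>1, 0) * gen (r\<^sub>2, Z\<^sub>2))"
    by (rule mod_eq_sym, rule act.free_act_gen_gen)
  finally show ?thesis .
qed

lemma free_act_bracket:
  "free_act' x (gen a * gen b - gen b * gen a) \<approx> free_act' x (gen (sd_bracket A a b))"
proof -
  obtain r\<^sub>1 Z\<^sub>1 r\<^sub>2 Z\<^sub>2 where ab: "a = (r\<^sub>1, Z\<^sub>1)" "b = (r\<^sub>2, Z\<^sub>2)" by force
  define u where "u y z = (anchor A' (\<Psi> y Z\<^sub>1) (\<psi> z r\<^sub>2), lbracket A' (\<Psi> y Z\<^sub>1) (\<Psi> z Z\<^sub>2))" for y z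
  define v where "v y z = (anchor A' (\<Psi> y Z\<^sub>2) (\<psi> z r\<^sub>1), 0 :: 'm)" for y z
  note linear = A'.anchor_linear_left A'.anchor_linear_right
  have v_bilinear:
    "v (y + y') z = v y z + v y' z" "v y (z + z') = v y z + v y z'"
    "v (cscale C c y) z = sd_scale A' c (v y z)" "v y (cscale C c z) = sd_scale A' c (v y z)"
    for c y y' z z'
    using linear
    unfolding Vector_Spaces.linear_def module_hom_def module_hom_axioms_def
    by (simp_all add: v_def sd_scale_def \<psi>_add_left \<psi>_scale_left \<Psi>_add_left \<Psi>_scale_left)
  have swap: "(\<Sum>(y, z)\<leftarrow>comult C x. gen (pair_act y b) * gen (pair_act z a))
      \<approx> (\<Sum>(y, z)\<leftarrow>comult C x. gen (pair_act z b) * gen (pair_act y a))"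
    by (rule sum_comult_commute)
      (simp_all add: act.bilinear_intros act.add_left act.scale_left)
  have "free_act' x (gen a * gen b - gen b * gen a)
      \<approx> (\<Sum>(y, z)\<leftarrow>comult C x. gen (pair_act y a) * gen (pair_act z b))
        - (\<Sum>(y, z)\<leftarrow>comult C x. gen (pair_act z b) * gen (pair_act y a))"
    unfolding act.free_act_diff
    by (intro mod_eq_diff act.free_act_gen_gen mod_eq_trans[OF act.free_act_gen_gen swap])
  also have "\<dots> = (\<Sum>(y, z)\<leftarrow>comult C x.
      gen (pair_act y a) * gen (pair_act z b) - gen (pair_act z b) * gen (pair_act y a))"
    by (rule sum_list_diff)
  also have "\<dots> \<approx> (\<Sum>(y, z)\<leftarrow>comult C x. gen (sd_bracket A' (pair_act y a) (pair_act z b)))"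
    by (intro mod_eq_sum_list mod_eq_base) (unfold lr_relators_def lie_relators_def, blast)
  also have "\<dots> = (\<Sum>(y, z)\<leftarrow>comult C x. gen (u y z - v z y))"
    by (simp add: sd_bracket_def pair_act_def ab u_def v_def)
  also have "\<dots> \<approx> (\<Sum>(y, z)\<leftarrow>comult C x. gen (u y z) - gen (v z y))"
    by (intro mod_eq_sum_list act.mod_eq_gen_diff)
  also have "\<dots> = (\<Sum>(y, z)\<leftarrow>comult C x. gen (u y z)) - (\<Sum>(y, z)\<leftarrow>comult C x. gen (v z y))"
    by (rule sum_list_diff[symmetric])
  also have "\<dots> \<approx> (\<Sum>(y, z)\<leftarrow>comult C x. gen (u y z)) - (\<Sum>(y, z)\<leftarrow>comult C x. gen (v y z))"
    by (intro mod_eq_diff mod_eq_refl, rule mod_eq_sym, rule sum_comult_commute)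
      (simp_all add: v_bilinear act.bilinear_intros)
  also have "\<dots> \<approx> gen (\<Sum>(y, z)\<leftarrow>comult C x. u y z) - gen (\<Sum>(y, z)\<leftarrow>comult C x. v y z)"
    by (intro mod_eq_diff mod_eq_sym[OF act.mod_eq_gen_sum_list])
  also have "\<dots> \<approx> gen ((\<Sum>(y, z)\<leftarrow>comult C x. u y z) - (\<Sum>(y, z)\<leftarrow>comult C x. v y z))"
    by (rule mod_eq_sym, rule act.mod_eq_gen_diff)
  also have "(\<Sum>(y, z)\<leftarrow>comult C x. u y z) - (\<Sum>(y, z)\<leftarrow>comult C x. v y z)
      = pair_act x (sd_bracket A a b)"
    unfolding u_def v_def sum_list_Pair
    by (simp add: sd_bracket_def pair_act_def ab \<psi>_diff \<psi>_anchor \<Psi>_lbracket split_def)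
  also have "gen \<dots> \<approx> free_act' x (gen (sd_bracket A a b))"
    by (rule mod_eq_sym, rule act.free_act_gen)
  finally show ?thesis .
qed

lemma free_act_relators:
  assumes "s \<in> lr_relators A"
  shows "free_act' x s \<approx> 0"
proof -
  have *: "free_act' x (p - q) \<approx> 0" if "free_act' x p \<approx> free_act' x q" for p q
    using that by (simp add: act.free_act_diff mod_eq_def)
  show ?thesis
    using assms *[OF free_act_bracket] *[OF free_act_ract] *[OF free_act_unit]
      act.free_act_lin_relators
    by (auto simp: lr_relators_def lie_relators_def ract_relators_def)
qed

definition induced :: "'c \<Rightarrow> (('r \<times> 'l) list \<Rightarrow>\<^sub>0 'k) set set \<Rightarrow> (('s \<times> 'm) list \<Rightarrow>\<^sub>0 'k) set set" where
  "induced x a = A'.V_proj (free_act' x (SOME p. A.V_proj p = a))"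

lemma induced_V_proj: "induced x (A.V_proj p) = A'.V_proj (free_act' x p)"
proof -
  have "A.V_proj (SOME q. A.V_proj q = A.V_proj p) = A.V_proj p"
    by (rule someI) (rule refl)
  then have "mod_eq (lr_relators A) (SOME q. A.V_proj q = A.V_proj p) p"
    by (rule iffD1[OF A.V_proj_eq_iff])
  then show ?thesis
    unfolding induced_def A'.V_proj_eq_iff
    by (rule act.free_act_cong[OF free_act_relators, rotated])
qed

lemma induced_lr_V_map: "induced x (lr_V_map A (r, Z)) = lr_V_map A' (\<psi> x r, \<Psi> x Z)"
  using act.free_act_gen[of x "(r, Z)"] induced_V_proj[of x "gen (r, Z)"]
  by (simp add: A.V_proj_gen A'.V_proj_gen A'.V_proj_eq_iff[symmetric] pair_act_def)

lemma alg_measuring_induced: "alg_measuring C (lr_V A) (lr_V A') induced"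
proof -
  have sum: "foldr (\<oplus>\<^bsub>lr_V A'\<^esub>) (map (\<lambda>(y, z). A'.V_proj (f y) \<otimes>\<^bsub>lr_V A'\<^esub> A'.V_proj (h z)) l)
      \<zero>\<^bsub>lr_V A'\<^esub> = A'.V_proj (\<Sum>(y, z)\<leftarrow>l. f y * h z)" for f h and l :: "('c \<times> 'c) list"
    by (induction l) (auto simp: A'.V.proj_sym)
  have mult: "induced x (A.V_proj p \<otimes>\<^bsub>lr_V A\<^esub> A.V_proj q) = foldr (\<oplus>\<^bsub>lr_V A'\<^esub>)
      (map (\<lambda>(y, z). induced y (A.V_proj p) \<otimes>\<^bsub>lr_V A'\<^esub> induced z (A.V_proj q)) (comult C x)) \<zero>\<^bsub>lr_V A'\<^esub>"
    for x p q
    unfolding induced_V_proj sum A.V.proj_mult_sym[OF UNIV_I UNIV_I] A'.V_proj_eq_iff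
    by (rule act.free_act_mult)
  show ?thesis
    unfolding alg_measuring_def Pi_iff A.V.ball_carrier_iff
    using act.free_act_add_left act.free_act_scale_left
    by (simp add: mult) (simp add: A.k_algebra_lr_V A'.k_algebra_lr_V A.V.proj_add_sym
        A'.V.proj_add_sym A.V.proj_scalar_sym A'.V.proj_scalar_sym induced_V_proj
        A'.V.proj_carrier A'.V_proj_eq_iff act.free_act_add act.free_act_scalar act.free_act_1
        flip: A.V_proj_1 A'.V_proj_1)
qed

end

theorem lemma7p3:
  fixes C :: "('k::field_char_0, 'c::ab_group_add) coalgebra_data"
    and A :: "('k, 'r::{comm_ring, comm_monoid_mult}, 'l::ab_group_add) lie_rinehart_data"
    and A' :: "('k, 's::{comm_ring, comm_monoid_mult}, 'm::ab_group_add) lie_rinehart_data"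
    and \<Psi> :: "'c \<Rightarrow> 'l \<Rightarrow> 'm"
    and \<psi> :: "'c \<Rightarrow> 'r \<Rightarrow> 's"
  assumes "cocommutative_coalgebra C"
    and "lie_rinehart A"
    and "lie_rinehart A'"
    and "lr_measuring C A A' \<Psi> \<psi>"
  shows "\<exists>\<Phi>. alg_measuring C (lr_V A) (lr_V A') \<Phi> \<and>
    (\<forall>x r Z. \<Phi> x (lr_V_map A (r, Z)) = lr_V_map A' (\<psi> x r, \<Psi> x Z))"
proof -
  interpret measured_lie_rinehart C A A' \<Psi> \<psi>
    using assms by (simp add: measured_lie_rinehart_def measured_lie_rinehart_axioms_def)
  show ?thesis using alg_measuring_induced induced_lr_V_map by blast
qed

end
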